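(* Let $1<\alpha<2$, let $A$ be a closed linear operator on a Banach space $X$, and suppose that $A$ generates the $(\alpha,1)$-resolvent family $\{S_{\alpha,1}(t)\}_{t\ge 0}$. Let $x,y\in X$ and $T>0$, and let $u(t;x,y)=S_{\alpha,1}(t)x+(g_1\ast S_{\alpha,1})(t)y$ be the solution of $\partial_t^\alpha u(t)=Au(t)$, $t\ge 0$, $u(0)=x$, $u'(0)=y$ (Caputo derivative). Then the order $\alpha$ satisfies $$Tu(T;x,y)-(g_1\ast u)(T;x,y)-(g_2\ast S_{\alpha,1})(T)y=\alpha\,\varphi_T(x),$$ where $\varphi_t(x):=(S_{\alpha,1}\ast u)(t;x,y)-(g_1\ast u)(t;x,y)$.
   Context: Conventions. For $\gamma>0$, $g_\gamma(t):=t^{\gamma-1}/\Gamma(\gamma)$ (so $g_1\equiv 1$, $g_2(t)=t$). The finite convolution is $(f\ast g)(t):=\int_0^t f(t-s)g(s)\,ds$; thus $(g_1\ast u)(t;x,y)=\int_0^t u(s;x,y)\,ds$ and $(S_{\alpha,1}\ast u)(t;x,y)=\int_0^t S_{\alpha,1}(t-s)u(s;x,y)\,ds$. For $1<\alpha<2$ the Caputo derivative is $\partial_t^\alpha f(t)=\int_0^t g_{2-\alpha}(t-s)f''(s)\,ds$. Resolvent families. Let $A$ be a closed linear operator on a Banach space $X$ and $\alpha,\beta>0$. $A$ is the generator of an $(\alpha,\beta)$-resolvent family if there exist $\omega\ge 0$ and a strongly continuous function $S_{\alpha,\beta}:(0,\infty)\to\mathcal{B}(X)$ (bounded linear operators on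 $X$) that is exponentially bounded (there are $M>0$, $w\in\mathbb{R}$ with $\|S_{\alpha,\beta}(t)\|\le Me^{wt}$ for $t>0$), with $\{\lambda^\alpha:\mathrm{Re}\,\lambda>\omega\}\subset\rho(A)$, such that for all $x\in X$ and $\mathrm{Re}\,\lambda>\omega$, $\lambda^{\alpha-\beta}(\lambda^\alpha-A)^{-1}x=\int_0^\infty e^{-\lambda t}S_{\alpha,\beta}(t)x\,dt$. Then $\{S_{\alpha,\beta}(t)\}$ is called the $(\alpha,\beta)$-resolvent family generated by $A$. For $\beta=1$, $S_{\alpha,1}(0)=I$. *)

theory Defs
  imports "HOL-Analysis.Analysis"
begin

section \<open>Complex Banach spaces\<close>

text \<open>
  The library only has real Banach spaces. The resolvent family below involves resolvents at
  complex points, so a compatible complex scalar multiplication is added.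
\<close>

class complex_banach = banach +
  fixes scaleC :: "complex \<Rightarrow> 'a \<Rightarrow> 'a"  (infixr "*\<^sub>C" 75)
  assumes scaleC_add_right: "c *\<^sub>C (x + y) = c *\<^sub>C x + c *\<^sub>C y"
    and scaleC_add_left: "(c + d) *\<^sub>C x = c *\<^sub>C x + d *\<^sub>C x"
    and scaleC_scaleC: "c *\<^sub>C d *\<^sub>C x = (c * d) *\<^sub>C x"
    and scaleC_of_real: "complex_of_real r *\<^sub>C x = r *\<^sub>R x"
    and norm_scaleC: "norm (c *\<^sub>C x) = cmod c * norm x"

instantiation complex :: complex_banach
begin
definition scaleC_complex :: "complex \<Rightarrow> complex \<Rightarrow> complex"
  where "scaleC_complex c x = c * x"
instance
  by standard (simp_all add: scaleC_complex_def algebra_simps norm_mult scaleR_conv_of_real)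
end

section \<open>Closed operators and resolvents\<close>

text \<open>
  An unbounded operator is given by its domain \<open>D\<close> and a total function \<open>A\<close> whose values
  outside \<open>D\<close> are irrelevant. The domain need not be dense.
\<close>

definition closed_linear_operator :: "'a::complex_banach set \<Rightarrow> ('a \<Rightarrow> 'a) \<Rightarrow> bool" where
  "closed_linear_operator D A \<longleftrightarrow>
     0 \<in> D \<and>
     (\<forall>x\<in>D. \<forall>y\<in>D. x + y \<in> D \<and> A (x + y) = A x + A y) \<and>
     (\<forall>c. \<forall>x\<in>D. c *\<^sub>C x \<in> D \<and> A (c *\<^sub>C x) = c *\<^sub>C A x) \<and>
     closed {(x, A x) | x. x \<in> D}"

definition resolvent_op ::
  "'a::complex_banach set \<Rightarrow> ('a \<Rightarrow> 'a) \<Rightarrow> complex \<Rightarrow> 'a \<Rightarrow> 'a" where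
  "resolvent_op D A \<mu> = inv_into D (\<lambda>x. \<mu> *\<^sub>C x - A x)"

definition resolvent_set :: "'a::complex_banach set \<Rightarrow> ('a \<Rightarrow> 'a) \<Rightarrow> complex set" where
  "resolvent_set D A =
     {\<mu>. bij_betw (\<lambda>x. \<mu> *\<^sub>C x - A x) D UNIV \<and> bounded_linear (resolvent_op D A \<mu>)}"

section \<open>Resolvent families\<close>

text \<open>
  Elements of the type \<open>'a \<Rightarrow>\<^sub>L 'a\<close> are only real-linear, hence the separate
  complex homogeneity. The Laplace integral is a Henstock-Kurzweil integral, because the
  Bochner integral of the library requires a separable space; over an unbounded
  interval it includes improper integrals. Strong continuity is required on \<open>t > 0\<close> only,
  and for \<open>\<beta> = 1\<close> the value at 0 is the identity. The complex powers are
  principal ones (note that \<open>Re z > \<omega> \<ge> 0\<close>).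
\<close>

definition resolvent_family ::
  "real \<Rightarrow> real \<Rightarrow> 'a::complex_banach set \<Rightarrow> ('a \<Rightarrow> 'a) \<Rightarrow> (real \<Rightarrow> 'a \<Rightarrow>\<^sub>L 'a) \<Rightarrow> bool" where
  "resolvent_family \<alpha> \<beta> D A S \<longleftrightarrow>
     \<alpha> > 0 \<and> \<beta> > 0 \<and>
     (\<forall>t>0. \<forall>c x. blinfun_apply (S t) (c *\<^sub>C x) = c *\<^sub>C blinfun_apply (S t) x) \<and>
     (\<forall>x. continuous_on {0<..} (\<lambda>t. blinfun_apply (S t) x)) \<and>
     (\<exists>M>0. \<exists>w. \<forall>t>0. norm (S t) \<le> M * exp (w * t)) \<and>
     (\<exists>\<omega>\<ge>0.
        {z powr complex_of_real \<alpha> | z. Re z > \<omega>} \<subseteq> resolvent_set D A \<and>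
        (\<forall>x z. Re z > \<omega> \<longrightarrow>
           ((\<lambda>t. exp (- z * complex_of_real t) *\<^sub>C blinfun_apply (S t) x) has_integral
             (z powr complex_of_real (\<alpha> - \<beta>)) *\<^sub>C
               resolvent_op D A (z powr complex_of_real \<alpha>) x) {0<..})) \<and>
     (\<beta> = 1 \<longrightarrow> S 0 = id_blinfun)"

section \<open>Finite convolutions\<close>

text \<open>The case distinction is there because \<open>0 powr 0 = 0\<close>, whereas \<open>g\<^sub>1\<close> is constantly 1.\<close>

definition gker :: "real \<Rightarrow> real \<Rightarrow> real" where
  "gker \<gamma> t = (if \<gamma> = 1 then 1 else t powr (\<gamma> - 1) / Gamma \<gamma>)"

lemma gker_eq: "t > 0 \<Longrightarrow> gker \<gamma> t = t powr (\<gamma> - 1) / Gamma \<gamma>"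
  by (simp add: gker_def)

lemma gker_1: "gker 1 t = 1"
  by (simp add: gker_def)

lemma gker_2: "t \<ge> 0 \<Longrightarrow> gker 2 t = t"
  using Gamma_fact[of 1, where 'a = real] by (simp add: gker_def)

text \<open>
  The parameter \<open>p\<close> is the product of the values of \<open>f\<close> and \<open>g\<close>: scalar multiplication
  or application of an operator to a vector. For a scalar kernel \<open>k\<close> and an operator family \<open>S\<close>,
  which is only strongly continuous, \<open>(k * S)(t) y\<close> is understood strongly, i.e. as the
  convolution of \<open>k\<close> with \<open>\<lambda>s. S s y\<close>.
\<close>

definition finite_conv ::
  "('b \<Rightarrow> 'c \<Rightarrow> 'a::real_normed_vector) \<Rightarrow> (real \<Rightarrow> 'b) \<Rightarrow> (real \<Rightarrow> 'c) \<Rightarrow> real \<Rightarrow> 'a" where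
  "finite_conv p f g t = integral {0..t} (\<lambda>s. p (f (t - s)) (g s))"

abbreviation conv_scalar ::
  "(real \<Rightarrow> real) \<Rightarrow> (real \<Rightarrow> 'a::real_normed_vector) \<Rightarrow> real \<Rightarrow> 'a" where
  "conv_scalar \<equiv> finite_conv scaleR"

abbreviation conv_op ::
  "(real \<Rightarrow> 'a::real_normed_vector \<Rightarrow>\<^sub>L 'a) \<Rightarrow> (real \<Rightarrow> 'a) \<Rightarrow> real \<Rightarrow> 'a" where
  "conv_op \<equiv> finite_conv blinfun_apply"

section \<open>The solution and the functional of the fractional Cauchy problem\<close>

definition cauchy_solution ::
  "(real \<Rightarrow> 'a::complex_banach \<Rightarrow>\<^sub>L 'a) \<Rightarrow> 'a \<Rightarrow> 'a \<Rightarrow> real \<Rightarrow> 'a" where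
  "cauchy_solution S x y t =
     blinfun_apply (S t) x + conv_scalar (gker 1) (\<lambda>s. blinfun_apply (S s) y) t"

definition phi ::
  "(real \<Rightarrow> 'a::complex_banach \<Rightarrow>\<^sub>L 'a) \<Rightarrow> 'a \<Rightarrow> 'a \<Rightarrow> real \<Rightarrow> 'a" where
  "phi S x y t =
     conv_op S (cauchy_solution S x y) t - conv_scalar (gker 1) (cauchy_solution S x y) t"

end

theory Submission
  imports Defs
begin

text \<open>
  Write \<open>R(\<mu>)\<close> for the resolvent of \<open>A\<close> at \<open>\<mu>\<close> and \<open>H(l) = l\<^sup>\<alpha>\<^sup>-\<^sup>1 R(l\<^sup>\<alpha>)\<close> for the Laplace transform of
  \<open>S\<close>. The resolvent identity gives \<open>H'(l) = (\<alpha> - 1) / l H(l) - \<alpha> H(l)\<^sup>2\<close>, and multiplication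
  by \<open>t\<close> corresponds to \<open>-d/dl\<close>, so both sides of the identity have the same Laplace transform;
  here the transform of \<open>u\<close> is \<open>H(l) x + H(l) y / l\<close>. Real \<open>l\<close> suffice. To work with Lebesgue
  integrals, Fubini and dominated convergence, which the library lacks for a nonseparable space,
  everything is tested against bounded real-linear functionals, which separate points by the
  Hahn-Banach theorem.
\<close>

section \<open>Functionals separating points\<close>

text \<open>On the transform side the identity is a short cancellation. Write
  \<open>U = H x + H y / l\<close> for the transform of \<open>u\<close>. Then \<open>- U'\<close>
  equals \<open>\<alpha> H (H x + H y / l) - (\<alpha> - 1) U / l + H y / l^2\<close>. The last term
  comes from differentiating \<open>1 / l\<close> and is removed by the convolution of g_2 with
  \<open>S\<close>; subtracting \<open>U / l\<close> for the convolution of g_1 with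
  \<open>u\<close> turns \<open>\<alpha> - 1\<close> into \<open>\<alpha>\<close>. What remains is
  \<open>\<alpha>\<close> times the transform of \<open>phi\<close>. The obstacle is the point 0:
  the family is strongly continuous for \<open>t > 0\<close> only, and near 0 nothing but a bound is
  available. Growth conditions are therefore imposed on open sets, and even integrability over
  \<open>{0..t}\<close> needs a proof. Each factor \<open>t\<close> and each convolution is absorbed
  by \<open>t <= exp t\<close> and raises the growth rate by one; the half-line \<open>l > L\<close>
  lies beyond all rates that arise.\<close>

lemma exists_bounded_linear_functional:
  fixes x :: "'a::real_normed_vector"
  assumes "x \<noteq> 0"
  shows "\<exists>f::'a \<Rightarrow> real. bounded_linear f \<and> f x \<noteq> 0"
proof -
  \<comment> \<open>Graphs of functionals on subspaces, dominated by the norm. Domination already makes such a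
    subspace of the product single-valued.\<close>
  define \<G> :: "('a \<times> real) set set" where
    "\<G> = {G. subspace G \<and> (x, norm x) \<in> G \<and> (\<forall>z r. (z, r) \<in> G \<longrightarrow> r \<le> norm z)}"
  have "\<exists>M\<in>\<G>. \<forall>X\<in>\<G>. M \<subseteq> X \<longrightarrow> X = M"
  proof (rule subset_Zorn_nonempty)
    have "r \<le> norm z" if zr: "(z, r) \<in> span {(x, norm x)}" for z r
    proof -
      obtain k where "(z, r) = k *\<^sub>R (x, norm x)"
        using zr by (auto simp: span_singleton)
      then show ?thesis by (auto intro: mult_right_mono)
    qed
    then have "span {(x, norm x)} \<in> \<G>"
      by (auto simp: \<G>_def span_base)
    then show "\<G> \<noteq> {}" by blast
  next
    fix \<C> assume ne: "\<C> \<noteq> {}" and ch: "subset.chain \<G> \<C>"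
    have sub: "G \<in> \<C> \<Longrightarrow> G \<in> \<G>" for G
      using ch by (auto simp: subset.chain_def)
    have "subspace (\<Union>\<C>)"
      unfolding subspace_def
    proof (intro conjI ballI allI)
      show "0 \<in> \<Union>\<C>" using ne sub by (fastforce simp: \<G>_def subspace_0)
    next
      fix p q assume "p \<in> \<Union>\<C>" "q \<in> \<Union>\<C>"
      then obtain P Q where PQ: "P \<in> \<C>" "p \<in> P" "Q \<in> \<C>" "q \<in> Q" by blast
      then have "P \<subseteq> Q \<or> Q \<subseteq> P"
        using ch by (auto simp: subset_chain_def)
      then show "p + q \<in> \<Union>\<C>"
        using PQ sub[of P] sub[of Q] by (auto simp: \<G>_def) (meson subsetD subspace_add)+
    next
      fix c p assume "p \<in> \<Union>\<C>"
      then show "c *\<^sub>R p \<in> \<Union>\<C>"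
        using sub by (auto simp: \<G>_def intro: subspace_scale)
    qed
    then show "\<Union>\<C> \<in> \<G>"
      using ne sub by (auto simp: \<G>_def)
  qed
  then obtain M where M: "M \<in> \<G>" and max: "\<And>X. X \<in> \<G> \<Longrightarrow> M \<subseteq> X \<Longrightarrow> X = M"
    by blast
  have sM: "subspace M" and xM: "(x, norm x) \<in> M"
    and dom: "\<And>z r. (z, r) \<in> M \<Longrightarrow> r \<le> norm z"
    using M by (auto simp: \<G>_def)
  have total: "\<exists>r. (v, r) \<in> M" for v
  proof -
    \<comment> \<open>Extending to \<open>v\<close> means choosing a value \<open>c\<close> there.
      By homogeneity only \<open>v\<close> and \<open>- v\<close> matter, which asks for
      \<open>r - c <= norm (z - v)\<close> and \<open>r + c <= norm (z + v)\<close> on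
      \<open>M\<close>. The supremum of \<open>L\<close> is the least \<open>c\<close> allowed by
      the first condition, and \<open>sep\<close> shows that it meets the second.\<close>
    define L where "L = {r - norm (z - v) | z r. (z, r) \<in> M}"
    define c where "c = Sup L"
    have sep: "r - norm (z - v) \<le> norm (z' + v) - r'" if "(z, r) \<in> M" "(z', r') \<in> M" for z r z' r'
    proof -
      have "(z + z', r + r') \<in> M"
        using subspace_add[OF sM that] by simp
      \<comment> \<open>\<open>z + z'\<close> is split so that \<open>v\<close> cancels and
        domination on \<open>M\<close> compares both sides.\<close>
      then have "r + r' \<le> norm ((z - v) + (z' + v))"
        using dom by simp
      then show ?thesis
        using norm_triangle_ineq[of "z - v" "z' + v"] by linarith
    qed
    have bdd: "bdd_above L"
      using sep[OF _ xM] by (auto simp: L_def bdd_above_def)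
    have lower: "r - c \<le> norm (z - v)" if "(z, r) \<in> M" for z r
      using cSup_upper[of "r - norm (z - v)" L] that bdd by (force simp: L_def c_def)
    have upper: "r + c \<le> norm (z + v)" if "(z, r) \<in> M" for z r
    proof -
      have "c \<le> norm (z + v) - r"
        unfolding c_def using sep that xM by (intro cSup_least) (auto simp: L_def)
      then show ?thesis by simp
    qed
    define X where "X = span (insert (v, c) M)"
    have "r \<le> norm z" if zr: "(z, r) \<in> X" for z r
    proof -
      obtain k where k: "(z - k *\<^sub>R v, r - k * c) \<in> M"
        using zr by (auto simp: X_def span_insert span_eq_iff[THEN iffD2, OF sM])
      consider "k = 0" | "k > 0" | "k < 0" by linarith
      then show ?thesis
      proof cases
        case 1
        then show ?thesis using k dom by simp
      next
        case 2
        have "((1/k) *\<^sub>R (z - k *\<^sub>R v), (1/k) * (r - k * c)) \<in> M"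
          using subspace_scale[OF sM k, of "1/k"] by simp
        from upper[OF this] have "r / k \<le> norm ((1/k) *\<^sub>R z)"
          using 2 by (simp add: algebra_simps)
        then show ?thesis using 2 by (simp add: field_simps)
      next
        case 3
        have "((-1/k) *\<^sub>R (z - k *\<^sub>R v), (-1/k) * (r - k * c)) \<in> M"
          using subspace_scale[OF sM k, of "-1/k"] by simp
        from lower[OF this] have "- (r / k) \<le> norm ((-1/k) *\<^sub>R z)"
          using 3 by (simp add: algebra_simps)
        then show ?thesis using 3 by (simp add: field_simps)
      qed
    qed
    moreover have "M \<subseteq> X" "(v, c) \<in> X"
      unfolding X_def by (auto intro: span_base)
    moreover have "subspace X" by (simp add: X_def)
    ultimately have "X \<in> \<G>" using xM by (auto simp: \<G>_def)
    then show ?thesis using max \<open>M \<subseteq> X\<close> \<open>(v, c) \<in> X\<close> by blast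
  qed
  have uniq: "r = r'" if "(v, r) \<in> M" "(v, r') \<in> M" for v r r'
    using dom[of 0 "r - r'"] dom[of 0 "r' - r"] subspace_diff[OF sM that]
      subspace_diff[OF sM that(2) that(1)] by simp
  define f where "f v = (THE r. (v, r) \<in> M)" for v
  have fM: "(v, f v) \<in> M" for v
    unfolding f_def using total[of v] uniq by (metis theI)
  have feq: "f v = r" if "(v, r) \<in> M" for v r
    using uniq fM that by blast
  have "bounded_linear f"
  proof (rule bounded_linear_intro[where K = 1])
    show "f (v + w) = f v + f w" for v w
      using subspace_add[OF sM fM fM, of v w] by (auto intro: feq)
    show "f (r *\<^sub>R v) = r *\<^sub>R f v" for r v
      using subspace_scale[OF sM fM, of r v] by (auto intro: feq)
    \<comment> \<open>Domination is one-sided; the lower bound comes from applying it to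
      \<open>- v\<close>.\<close>
    show "norm (f v) \<le> norm v * 1" for v
      using dom[OF fM, of v] dom[of "-v" "- f v"] subspace_neg[OF sM fM, of v] by auto
  qed
  moreover have "f x = norm x" using xM by (rule feq)
  ultimately show ?thesis using assms by force
qed

section \<open>Laplace transforms of functions of exponential type\<close>

text \<open>
  The fundamental theorem of calculus allows exceptional endpoints, so it is enough to extend an
  antiderivative continuously from the open interval; it is Lipschitz there.
\<close>

lemma integrable_on_bounded_continuous:
  fixes h :: "real \<Rightarrow> 'a::banach"
  assumes cont: "continuous_on {a<..<b} h" and bound: "\<And>s. s \<in> {a<..<b} \<Longrightarrow> norm (h s) \<le> B"
  shows "h integrable_on {a..b}"
proof (cases "a < b")
  case False
  then consider "a = b" | "b < a" by linarith
  then show ?thesis by cases (use integrable_on_refl[of h b] in auto)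
next
  case True
  define c where "c = (a + b) / 2"
  have c: "a < c" "c < b" using True by (auto simp: c_def field_simps)
  \<comment> \<open>Anchored at the midpoint, because integrability of \<open>h\<close> up to the
    endpoints is not yet known.\<close>
  define G where "G s = (if c \<le> s then integral {c..s} h else - integral {s..c} h)" for s
  have deriv: "(G has_vector_derivative h s) (at s)" if s: "s \<in> {a<..<b}" for s
  proof -
    \<comment> \<open>Both \<open>c\<close> and \<open>s\<close> lie inside \<open>(p, q)\<close>,
      while \<open>[p, q]\<close> stays inside \<open>(a, b)\<close>; there \<open>G\<close> differs
      by a constant from the integral with fixed lower limit \<open>p\<close>.\<close>
    define p q where "p = (a + min c s) / 2" and "q = (b + max c s) / 2"
    have pq: "a < p" "p < c" "p < s" "c < q" "s < q" "q < b"
      using c s by (auto simp: p_def q_def min_def max_def field_simps)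
    have contpq: "continuous_on {p..q} h"
      using pq by (intro continuous_on_subset[OF cont]) auto
    have int: "h integrable_on {p..t}" if "t \<le> q" for t
      using that by (intro integrable_continuous_real continuous_on_subset[OF contpq]) auto
    have eq: "G t = integral {p..t} h - integral {p..c} h" if "t \<in> {p<..<q}" for t
    proof (cases "c \<le> t")
      case True
      then show ?thesis
        using Henstock_Kurzweil_Integration.integral_combine[OF _ _ int[of t], of c] pq that
        by (auto simp: G_def algebra_simps)
    next
      case False
      then show ?thesis
        using Henstock_Kurzweil_Integration.integral_combine[OF _ _ int[of c], of t] pq that
        by (auto simp: G_def algebra_simps)
    qed
    have "((\<lambda>t. integral {p..t} h) has_vector_derivative h s) (at s within {p..q})"
      using pq by (intro integral_has_vector_derivative contpq) auto
    then have "((\<lambda>t. integral {p..t} h) has_vector_derivative h s) (at s)"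
      using pq at_within_Icc_at[of p s q] by simp
    then have "((\<lambda>t. integral {p..t} h - integral {p..c} h) has_vector_derivative h s) (at s)"
      by (auto intro: derivative_eq_intros)
    then show ?thesis
      by (rule has_vector_derivative_transform_within_open[where S = "{p<..<q}"])
        (use pq eq in auto)
  qed
  have "B-lipschitz_on {a<..<b} G"
  proof (rule bounded_derivative_imp_lipschitz[where f' = "\<lambda>s k. k *\<^sub>R h s"])
    show "(G has_derivative (\<lambda>k. k *\<^sub>R h s)) (at s within {a<..<b})" if "s \<in> {a<..<b}" for s
      using deriv[OF that] by (auto simp: has_vector_derivative_def intro: has_derivative_at_withinI)
    show "onorm (\<lambda>k. k *\<^sub>R h s) \<le> B" if "s \<in> {a<..<b}" for s
      using bound[OF that] by (intro onorm_le) (auto simp: mult.commute[of B] intro: mult_left_mono)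
    show "0 \<le> B" using order_trans[OF norm_ge_zero bound[of c]] c by auto
  qed (auto)
  then obtain F where F: "uniformly_continuous_on (closure {a<..<b}) F"
    and FG: "\<And>s. s \<in> {a<..<b} \<Longrightarrow> G s = F s"
    using uniformly_continuous_on_extension_on_closure[OF lipschitz_on_uniformly_continuous] by metis
  have "(h has_integral (F b - F a)) {a..b}"
  proof (rule fundamental_theorem_of_calculus_interior)
    show "continuous_on {a..b} F"
      using uniformly_continuous_imp_continuous[OF F] True by simp
    show "(F has_vector_derivative h s) (at s)" if "s \<in> {a<..<b}" for s
      by (rule has_vector_derivative_transform_within_open[OF deriv[OF that], where S = "{a<..<b}"])
        (use that FG in auto)
  qed (use True in auto)
  then show ?thesis by blast
qed

text \<open>Neither a value nor continuity at 0 is prescribed, as the family is strongly continuous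
  on \<open>t > 0\<close> only; the bound still gives integrability near 0.\<close>

definition exp_type :: "real \<Rightarrow> (real \<Rightarrow> 'a::real_normed_vector) \<Rightarrow> bool" where
  "exp_type w a \<longleftrightarrow> continuous_on {0<..} a \<and> (\<exists>C. \<forall>t>0. norm (a t) \<le> C * exp (w * t))"

definition laplace :: "(real \<Rightarrow> real) \<Rightarrow> real \<Rightarrow> real" where
  "laplace a l = (LINT t:{0<..}|lborel. exp (- (l * t)) * a t)"

lemma exp_typeI:
  assumes "continuous_on {0<..} a" "\<And>t. t > 0 \<Longrightarrow> norm (a t) \<le> C * exp (w * t)"
  shows "exp_type w a"
  using assms unfolding exp_type_def by blast

lemma exp_typeE:
  assumes "exp_type w a"
  obtains C where "C \<ge> 0" "\<And>t. t > 0 \<Longrightarrow> norm (a t) \<le> C * exp (w * t)"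
proof -
  obtain C where C: "\<And>t. t > 0 \<Longrightarrow> norm (a t) \<le> C * exp (w * t)"
    using assms unfolding exp_type_def by blast
  have "0 \<le> C * exp (w * 1)" using order_trans[OF norm_ge_zero C[of 1]] by simp
  then have "C \<ge> 0" by (simp add: zero_le_mult_iff)
  with C that show thesis by blast
qed

lemma exp_type_continuous: "exp_type w a \<Longrightarrow> continuous_on {0<..} a"
  by (simp add: exp_type_def)

lemma exp_type_mono:
  assumes "exp_type w a" "w \<le> w'"
  shows "exp_type w' a"
proof -
  obtain C where C: "C \<ge> 0" "\<And>t. t > 0 \<Longrightarrow> norm (a t) \<le> C * exp (w * t)"
    using exp_typeE[OF assms(1)] by blast
  show ?thesis
  proof (rule exp_typeI[OF exp_type_continuous[OF assms(1)]])
    show "norm (a t) \<le> C * exp (w' * t)" if "t > 0" for t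
      using C(1) assms(2) that by (intro order_trans[OF C(2)[OF that]] mult_left_mono) auto
  qed
qed

lemma exp_type_add:
  assumes "exp_type w a" "exp_type w b"
  shows "exp_type w (\<lambda>t. a t + b t)"
proof -
  obtain C where C: "C \<ge> 0" "\<And>t. t > 0 \<Longrightarrow> norm (a t) \<le> C * exp (w * t)"
    using exp_typeE[OF assms(1)] by blast
  obtain B where B: "B \<ge> 0" "\<And>t. t > 0 \<Longrightarrow> norm (b t) \<le> B * exp (w * t)"
    using exp_typeE[OF assms(2)] by blast
  show ?thesis
  proof (rule exp_typeI)
    show "norm (a t + b t) \<le> (C + B) * exp (w * t)" if "t > 0" for t
      using norm_triangle_ineq[of "a t" "b t"] C(2)[OF that] B(2)[OF that]
      by (simp add: algebra_simps)
  qed (intro continuous_intros assms[THEN exp_type_continuous])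
qed

lemma exp_type_bounded_linear:
  assumes "bounded_linear f" "exp_type w a"
  shows "exp_type w (\<lambda>t. f (a t))"
proof -
  interpret bounded_linear f by fact
  obtain C where C: "C \<ge> 0" "\<And>t. t > 0 \<Longrightarrow> norm (a t) \<le> C * exp (w * t)"
    using exp_typeE[OF assms(2)] by blast
  obtain K where K: "K \<ge> 0" "\<And>x. norm (f x) \<le> norm x * K"
    using nonneg_bounded by blast
  show ?thesis
  proof (rule exp_typeI)
    show "norm (f (a t)) \<le> (C * K) * exp (w * t)" if "t > 0" for t
      using mult_right_mono[OF C(2)[OF that] K(1)] K(2)[of "a t"] by (simp add: algebra_simps)
  qed (intro continuous_on exp_type_continuous[OF assms(2)])
qed

lemma exp_type_diff:
  assumes "exp_type w a" "exp_type w b"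
  shows "exp_type w (\<lambda>t. a t - b t)"
  using exp_type_add[OF assms(1) exp_type_bounded_linear[OF bounded_linear_minus[OF bounded_linear_ident] assms(2)]]
  by simp

lemma exp_type_cmult:
  fixes a :: "real \<Rightarrow> real"
  shows "exp_type w a \<Longrightarrow> exp_type w (\<lambda>t. c * a t)"
  by (rule exp_type_bounded_linear[OF bounded_linear_mult_right])

text \<open>\<open>t <= exp t\<close> trades the factor \<open>t\<close> for one unit of
  growth.\<close>

lemma exp_type_times_ident:
  fixes a :: "real \<Rightarrow> real"
  assumes "exp_type w a"
  shows "exp_type (w + 1) (\<lambda>t. t * a t)"
proof -
  obtain C where C: "C \<ge> 0" "\<And>t. t > 0 \<Longrightarrow> norm (a t) \<le> C * exp (w * t)"
    using exp_typeE[OF assms] by blast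
  show ?thesis
  proof (rule exp_typeI)
    show "norm (t * a t) \<le> C * exp ((w + 1) * t)" if "t > 0" for t
    proof -
      have "t \<le> exp t" using exp_ge_add_one_self[of t] by linarith
      then have "t * \<bar>a t\<bar> \<le> exp t * (C * exp (w * t))"
        using C(2)[OF that] that by (intro mult_mono) auto
      then show ?thesis using that by (simp add: abs_mult algebra_simps exp_add)
    qed
  qed (intro continuous_intros exp_type_continuous[OF assms])
qed

section \<open>Convergence and elementary rules of the transform\<close>

lemma set_integrable_exp_minus:
  assumes "(c::real) > 0"
  shows "set_integrable lborel {0<..} (\<lambda>t. exp (- (c * t)))"
    and "(LINT t:{0<..}|lborel. exp (- (c * t))) = 1 / c"
proof -
  have *: "((\<lambda>t. exp (- c * t)) has_integral exp (- c * 0) / c) {0<..}"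
  proof (rule has_integral_spike_set_eq[THEN iffD1, rotated 2])
    show "((\<lambda>t. exp (- c * t)) has_integral exp (- c * 0) / c) {0..}"
      by (rule has_integral_exp_minus_to_infinity[OF assms])
  qed (auto intro: negligible_subset[of "{0}"])
  have "set_integrable lebesgue {0<..} (\<lambda>t. exp (- (c * t)))"
    using * by (intro nonnegative_absolutely_integrable_1) auto
  then show i: "set_integrable lborel {0<..} (\<lambda>t. exp (- (c * t)))"
    by (auto simp: set_integrable_def integrable_completion)
  have "((\<lambda>t. exp (- (c * t))) has_integral (LINT t:{0<..}|lborel. exp (- (c * t)))) {0<..}"
    using set_borel_integral_eq_integral[OF i] by (simp add: integrable_integral)
  with * show "(LINT t:{0<..}|lborel. exp (- (c * t))) = 1 / c"
    by (auto dest: has_integral_unique)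
qed

lemma exp_type_set_integrable:
  fixes a :: "real \<Rightarrow> real"
  assumes "exp_type w a" "w < l"
  shows "set_integrable lborel {0<..} (\<lambda>t. exp (- (l * t)) * a t)"
proof -
  obtain C where C: "C \<ge> 0" "\<And>t. t > 0 \<Longrightarrow> norm (a t) \<le> C * exp (w * t)"
    using exp_typeE[OF assms(1)] by blast
  have "set_integrable lborel {0<..} (\<lambda>t. C * exp (- ((l - w) * t)))"
    using assms(2) by (intro set_integrable_mult_right set_integrable_exp_minus) auto
  then show ?thesis
  proof (rule set_integrable_bound)
    show "set_borel_measurable lborel {0<..} (\<lambda>t. exp (- (l * t)) * a t)"
      unfolding set_borel_measurable_def measurable_lborel2
      by (intro borel_measurable_continuous_on_indicator continuous_intros
          exp_type_continuous[OF assms(1)]) auto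
    show "AE t in lborel. t \<in> {0<..} \<longrightarrow> norm (exp (- (l * t)) * a t) \<le> norm (C * exp (- ((l - w) * t)))"
    proof (intro AE_I2 impI)
      fix t :: real assume "t \<in> {0<..}"
      then have "exp (- (l * t)) * \<bar>a t\<bar> \<le> exp (- (l * t)) * (C * exp (w * t))"
        using C(2)[of t] by (intro mult_left_mono) auto
      then show "norm (exp (- (l * t)) * a t) \<le> norm (C * exp (- ((l - w) * t)))"
        using C(1) by (simp add: abs_mult algebra_simps exp_diff exp_minus field_simps)
    qed
  qed
qed

text \<open>The exponential bound gives absolute integrability, so the gauge integral in
  \<open>resolvent_family\<close> agrees with the Lebesgue integral in
  \<open>laplace\<close>.\<close>

lemma laplace_eq_has_integral:
  fixes a :: "real \<Rightarrow> real"
  assumes "exp_type w a" "w < l"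
    and "((\<lambda>t. exp (- (l * t)) * a t) has_integral I) {0<..}"
  shows "laplace a l = I"
  using set_borel_integral_eq_integral(2)[OF exp_type_set_integrable[OF assms(1,2)]] assms(3)
  by (simp add: laplace_def integral_unique)

lemma laplace_add:
  assumes "exp_type w a" "exp_type w b" "w < l"
  shows "laplace (\<lambda>t. a t + b t) l = laplace a l + laplace b l"
  using set_integral_add(2)[OF exp_type_set_integrable[OF assms(1,3)] exp_type_set_integrable[OF assms(2,3)]]
  by (simp add: laplace_def algebra_simps)

lemma laplace_diff:
  assumes "exp_type w a" "exp_type w b" "w < l"
  shows "laplace (\<lambda>t. a t - b t) l = laplace a l - laplace b l"
  using set_integral_diff(2)[OF exp_type_set_integrable[OF assms(1,3)] exp_type_set_integrable[OF assms(2,3)]]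
  by (simp add: laplace_def algebra_simps)

lemma laplace_cmult: "laplace (\<lambda>t. c * a t) l = c * laplace a l"
  unfolding laplace_def by (subst set_integral_mult_right[symmetric]) (simp add: mult.left_commute)

lemma laplace_const: "l > 0 \<Longrightarrow> laplace (\<lambda>t. c) l = c / l"
  using set_integrable_exp_minus(2)[of l] by (simp add: laplace_def)

lemma laplace_cong: "(\<And>t. t > 0 \<Longrightarrow> a t = b t) \<Longrightarrow> laplace a l = laplace b l"
  unfolding laplace_def by (intro set_lebesgue_integral_cong) auto

text \<open>Domination for differentiating under the integral: \<open>1 + x <= exp x\<close>
  replaces the mean value theorem, and all rates between \<open>l\<close> and \<open>m\<close> are
  at least \<open>l - d\<close>.\<close>

lemma exp_diff_quotient_le:
  fixes t l m d :: real
  assumes "t > 0" "\<bar>m - l\<bar> \<le> d"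
  shows "\<bar>(exp (- (m * t)) - exp (- (l * t))) / (m - l)\<bar> \<le> t * exp (- ((l - d) * t))"
proof -
  have exp_le: "exp p - exp q \<le> (p - q) * exp p" for p q :: real
    using mult_left_mono[OF exp_ge_add_one_self[of "q - p"], of "exp p"]
    by (simp add: algebra_simps flip: exp_add)
  have "\<bar>exp (- (m * t)) - exp (- (l * t))\<bar> \<le> \<bar>m - l\<bar> * (t * exp (- ((l - d) * t)))"
  proof (cases "m \<le> l")
    case True
    have "exp (- (m * t)) - exp (- (l * t)) \<le> (l - m) * t * exp (- (m * t))"
      using exp_le[of "- (m * t)" "- (l * t)"] by (simp add: algebra_simps)
    also have "\<dots> \<le> (l - m) * t * exp (- ((l - d) * t))"
      using assms True by (intro mult_left_mono) auto
    finally show ?thesis using True assms by (simp add: abs_if algebra_simps)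
  next
    case False
    have "exp (- (l * t)) - exp (- (m * t)) \<le> (m - l) * t * exp (- (l * t))"
      using exp_le[of "- (l * t)" "- (m * t)"] by (simp add: algebra_simps)
    also have "\<dots> \<le> (m - l) * t * exp (- ((l - d) * t))"
      using assms False by (intro mult_left_mono) auto
    finally show ?thesis using False assms by (simp add: abs_if algebra_simps)
  qed
  moreover have "0 \<le> t * exp (- ((l - d) * t))" using assms by simp
  \<comment> \<open>For \<open>m = l\<close> the quotient is 0, as division by 0 gives 0.\<close>
  ultimately show ?thesis
    by (cases "m = l") (auto simp: abs_divide pos_divide_le_eq mult.commute)
qed

lemma laplace_has_real_derivative:
  assumes a: "exp_type w a" and l: "w + 1 < l"
  shows "(laplace a has_real_derivative - laplace (\<lambda>t. t * a t) l) (at l)"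
proof -
  \<comment> \<open>Half of the distance from \<open>l\<close> to \<open>w + 1\<close>, the growth
    rate of \<open>t * a t\<close>: the dominating function with rate \<open>l - d\<close> stays
    integrable.\<close>
  define d where "d = (l - w - 1) / 2"
  have d: "d > 0" "w + 1 < l - d" using l by (auto simp: d_def field_simps)
  have "(\<lambda>n. (laplace a (X n) - laplace a l) / (X n - l)) \<longlonglongrightarrow> - laplace (\<lambda>t. t * a t) l"
    if Xl: "\<And>n. X n \<noteq> l" and X: "X \<longlonglongrightarrow> l" for X
  proof -
    define q where "q m t = (exp (- (m * t)) - exp (- (l * t))) / (m - l) * a t" for m t
    \<comment> \<open>Domination needs \<open>X n\<close> within \<open>d\<close> of
      \<open>l\<close>, hence the shift by \<open>N\<close> below.\<close>
    obtain N where N: "\<And>n. n \<ge> N \<Longrightarrow> \<bar>X n - l\<bar> < d"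
      using LIMSEQ_D[OF X d(1)] by auto
    have quot: "(laplace a m - laplace a l) / (m - l) = (LINT t:{0<..}|lborel. q m t)"
      if "\<bar>m - l\<bar> < d" for m
    proof -
      have "w < m" "w < l" using that d l by linarith+
      then have "laplace a m - laplace a l
          = (LINT t:{0<..}|lborel. exp (- (m * t)) * a t - exp (- (l * t)) * a t)"
        unfolding laplace_def by (intro set_integral_diff(2)[symmetric] exp_type_set_integrable[OF a])
      then show ?thesis
        by (simp add: q_def left_diff_distrib flip: set_integral_divide_zero)
    qed
    have "(\<lambda>n. LINT t:{0<..}|lborel. q (X (n + N)) t)
        \<longlonglongrightarrow> (LINT t:{0<..}|lborel. - (exp (- (l * t)) * (t * a t)))"
      unfolding set_lebesgue_integral_def
    proof (rule integral_dominated_convergence)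
      show "integrable lborel (\<lambda>t. \<bar>indicator {0<..} t *\<^sub>R (exp (- ((l - d) * t)) * (t * a t))\<bar>)"
        using exp_type_set_integrable[OF exp_type_times_ident[OF a] d(2)]
        unfolding set_integrable_def by (rule integrable_abs)
      show "(\<lambda>t. indicator {0<..} t *\<^sub>R - (exp (- (l * t)) * (t * a t))) \<in> borel_measurable lborel"
        unfolding measurable_lborel2
        by (intro borel_measurable_continuous_on_indicator continuous_intros exp_type_continuous[OF a]) auto
      show "(\<lambda>t. indicator {0<..} t *\<^sub>R q (X (n + N)) t) \<in> borel_measurable lborel" for n
        unfolding measurable_lborel2 q_def
        using Xl[of "n + N"]
        by (intro borel_measurable_continuous_on_indicator continuous_intros exp_type_continuous[OF a]) auto
      show "AE t in lborel. (\<lambda>n. indicator {0<..} t *\<^sub>R q (X (n + N)) t)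
          \<longlonglongrightarrow> indicator {0<..} t *\<^sub>R - (exp (- (l * t)) * (t * a t))"
      proof (intro AE_I2 tendsto_intros)
        fix t :: real
        have "((\<lambda>m. exp (- (m * t))) has_real_derivative - (exp (- (l * t)) * t)) (at l)"
          by (auto intro!: derivative_eq_intros)
        then have "(\<lambda>n. (exp (- (X n * t)) - exp (- (l * t))) / (X n - l)) \<longlonglongrightarrow> - (exp (- (l * t)) * t)"
          unfolding has_field_derivative_iff tendsto_at_iff_sequentially
          using Xl X by (auto simp: comp_def)
        then have "(\<lambda>n. q (X n) t) \<longlonglongrightarrow> - (exp (- (l * t)) * t) * a t"
          unfolding q_def by (rule tendsto_mult_right)
        then show "(\<lambda>n. q (X (n + N)) t) \<longlonglongrightarrow> - (exp (- (l * t)) * (t * a t))"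
          by (intro LIMSEQ_ignore_initial_segment) (simp add: mult.assoc)
      qed
      show "AE t in lborel. norm (indicator {0<..} t *\<^sub>R q (X (n + N)) t)
          \<le> \<bar>indicator {0<..} t *\<^sub>R (exp (- ((l - d) * t)) * (t * a t))\<bar>" for n
      proof (intro AE_I2)
        fix t :: real
        show "norm (indicator {0<..} t *\<^sub>R q (X (n + N)) t)
          \<le> \<bar>indicator {0<..} t *\<^sub>R (exp (- ((l - d) * t)) * (t * a t))\<bar>"
        proof (cases "t > 0")
          case True
          have "\<bar>q (X (n + N)) t\<bar> \<le> t * exp (- ((l - d) * t)) * \<bar>a t\<bar>"
            unfolding q_def abs_mult
            using N[of "n + N"] True by (intro mult_right_mono exp_diff_quotient_le) auto
          then show ?thesis using True by (simp add: abs_mult algebra_simps)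
        qed auto
      qed
    qed
    also have "(LINT t:{0<..}|lborel. - (exp (- (l * t)) * (t * a t))) = - laplace (\<lambda>t. t * a t) l"
      by (simp add: laplace_def set_lebesgue_integral_def)
    finally have "(\<lambda>n. (laplace a (X (n + N)) - laplace a l) / (X (n + N) - l))
        \<longlonglongrightarrow> - laplace (\<lambda>t. t * a t) l"
      using N by (simp add: quot)
    then show ?thesis by (rule LIMSEQ_offset)
  qed
  then show ?thesis
    unfolding has_field_derivative_iff tendsto_at_iff_sequentially by (auto simp: comp_def)
qed

text \<open>Lerch's uniqueness theorem. The zeros at \<open>m + n\<close> for natural
  \<open>n\<close> say that \<open>g\<close> is orthogonal to all powers of
  \<open>exp (- t)\<close>. By Weierstrass approximation on \<open>[0, 1]\<close> it is orthogonal
  to \<open>\<phi> (exp (- t))\<close> as well, and this product is the square of \<open>g\<close>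
  times a positive weight. So \<open>a\<close> vanishes almost everywhere on \<open>t > 0\<close>,
  and by continuity everywhere there.\<close>

lemma laplace_zero_imp_zero:
  assumes a: "exp_type w a" and zero: "\<And>l. L < l \<Longrightarrow> laplace a l = 0" and t: "t > 0"
  shows "a t = 0"
proof -
  \<comment> \<open>Above \<open>w\<close>, so that \<open>g\<close> is bounded and integrable;
    above \<open>L\<close>, so that every \<open>m + n\<close> is a zero of the transform.\<close>
  define m where "m = max w L + 1"
  have m: "w < m" "L < m" by (auto simp: m_def)
  define g where "g t = exp (- (m * t)) * a t" for t
  have intg: "set_integrable lborel {0<..} g"
    unfolding g_def by (rule exp_type_set_integrable[OF a m(1)])
  obtain C where C: "C \<ge> 0" "\<And>t. t > 0 \<Longrightarrow> norm (a t) \<le> C * exp (w * t)"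
    using exp_typeE[OF a] by blast
  have gC: "\<bar>g t\<bar> \<le> C" if "t > 0" for t
  proof -
    have "\<bar>g t\<bar> \<le> exp (- (m * t)) * (C * exp (w * t))"
      unfolding g_def abs_mult using C(2)[OF that] by (simp add: mult_left_mono)
    also have "\<dots> = C * exp (- ((m - w) * t))"
      by (simp add: algebra_simps exp_diff exp_minus field_simps)
    also have "\<dots> \<le> C * 1"
      using C(1) m that by (intro mult_left_mono) auto
    finally show ?thesis by simp
  qed
  have gcont: "continuous_on {0<..} g"
    unfolding g_def by (intro continuous_intros exp_type_continuous[OF a])
  have moments: "set_integrable lborel {0<..} (\<lambda>t. exp (- t) ^ n * g t)"
    "(LINT t:{0<..}|lborel. exp (- t) ^ n * g t) = 0" for n
  proof -
    have *: "exp (- t) ^ n * g t = exp (- ((m + n) * t)) * a t" for t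
      by (simp add: g_def algebra_simps exp_diff exp_minus exp_add field_simps flip: exp_of_nat_mult)
    show "set_integrable lborel {0<..} (\<lambda>t. exp (- t) ^ n * g t)"
      unfolding * using m by (intro exp_type_set_integrable[OF a]) auto
    show "(LINT t:{0<..}|lborel. exp (- t) ^ n * g t) = 0"
      unfolding * using zero[of "m + n"] m by (simp add: laplace_def)
  qed
  \<comment> \<open>With \<open>v = exp (- t)\<close> this is \<open>g t\<close>, damped at both ends so as to be continuous on \<open>[0, 1]\<close>.\<close>
  define \<phi> where "\<phi> v = v * (1 - v) * g (- ln v)" for v
  have contphi: "continuous_on {0..1} \<phi>"
  proof -
    have "(\<phi> \<longlongrightarrow> \<phi> v) (at v within {0..1})" if v: "v \<in> {0..1}" for v
    proof (cases "v = 0 \<or> v = 1")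
      case True
      \<comment> \<open>At the ends the factor \<open>v * (1 - v)\<close> forces the limit 0 because
        \<open>g\<close> is bounded on \<open>t > 0\<close>; the values of \<open>g\<close> at
        \<open>- ln 0\<close> and \<open>- ln 1\<close> are multiplied by 0.\<close>
      have bd: "\<bar>\<phi> z\<bar> \<le> C * (z * (1 - z))" if "z \<in> {0..1}" for z
      proof (cases "z = 0 \<or> z = 1")
        case False
        then have "\<bar>g (- ln z)\<bar> \<le> C" using that by (intro gC) auto
        then show ?thesis
          using that mult_left_mono[of "\<bar>g (- ln z)\<bar>" C "z * (1 - z)"]
          by (simp add: \<phi>_def abs_mult mult.commute)
      qed (auto simp: \<phi>_def)
      have "((\<lambda>z. C * (z * (1 - z))) \<longlongrightarrow> C * (v * (1 - v))) (at v within {0..1})"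
        by (intro tendsto_intros)
      then have "((\<lambda>z. C * (z * (1 - z))) \<longlongrightarrow> 0) (at v within {0..1})" using True by auto
      then have "(\<phi> \<longlongrightarrow> 0) (at v within {0..1})"
        by (rule Lim_null_comparison[rotated]) (auto simp: eventually_at_filter bd)
      then show ?thesis using True by (auto simp: \<phi>_def)
    next
      case False
      have "continuous_on {0<..<1} \<phi>"
        unfolding \<phi>_def
        by (intro continuous_intros continuous_on_compose2[OF gcont]) auto
      then have "isCont \<phi> v" using False v by (auto simp: continuous_on_eq_continuous_at)
      then show ?thesis by (auto simp: isCont_def intro: tendsto_within_subset)
    qed
    then show ?thesis by (simp add: continuous_on)
  qed
  define I where "I = (LINT t:{0<..}|lborel. \<phi> (exp (- t)) * g t)"
  have Nint: "set_integrable lborel {0<..} (\<lambda>t. \<phi> (exp (- t)) * g t)"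
  proof -
    have "set_integrable lborel {0<..} (\<lambda>t. C * g t)"
      using intg by (rule set_integrable_mult_right)
    then show ?thesis
    proof (rule set_integrable_bound)
      show "set_borel_measurable lborel {0<..} (\<lambda>t. \<phi> (exp (- t)) * g t)"
        unfolding set_borel_measurable_def measurable_lborel2
        by (intro borel_measurable_continuous_on_indicator continuous_intros gcont
            continuous_on_compose2[OF contphi]) auto
      have "\<bar>\<phi> (exp (- t))\<bar> \<le> C" if "t > 0" for t
      proof -
        have "exp (- t) * (1 - exp (- t)) * \<bar>g t\<bar> \<le> 1 * C"
          using gC[OF that] that by (intro mult_mono mult_le_one) auto
        then show ?thesis using that by (simp add: \<phi>_def abs_mult)
      qed
      then show "AE t in lborel. t \<in> {0<..} \<longrightarrow> norm (\<phi> (exp (- t)) * g t) \<le> norm (C * g t)"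
        using C(1) by (intro AE_I2) (auto simp: abs_mult intro: mult_right_mono)
    qed
  qed
  have I_le: "\<bar>I\<bar> \<le> e * (LINT t:{0<..}|lborel. \<bar>g t\<bar>)" if e: "e > 0" for e
  proof -
    obtain p where p: "real_polynomial_function p" "\<And>v. v \<in> {0..1} \<Longrightarrow> \<bar>\<phi> v - p v\<bar> < e"
      using Stone_Weierstrass_real_polynomial_function[OF compact_Icc contphi e] by blast
    obtain c n where pc: "p = (\<lambda>v. \<Sum>i\<le>n. c i * v ^ i)"
      using real_polynomial_function_imp_sum[OF p(1)] by blast
    have pg: "(\<lambda>t. p (exp (- t)) * g t) = (\<lambda>t. \<Sum>i\<le>n. c i * (exp (- t) ^ i * g t))"
      by (simp add: pc sum_distrib_right mult.assoc)
    have pint: "set_integrable lborel {0<..} (\<lambda>t. p (exp (- t)) * g t)"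
      unfolding pg set_integrable_def scaleR_sum_right
      by (intro Bochner_Integration.integrable_sum set_integrable_mult_right[unfolded set_integrable_def]
          moments(1)[unfolded set_integrable_def])
    have "(LINT t:{0<..}|lborel. p (exp (- t)) * g t)
        = (\<Sum>i\<le>n. LINT t:{0<..}|lborel. c i * (exp (- t) ^ i * g t))"
      unfolding pg set_lebesgue_integral_def scaleR_sum_right
      by (intro Bochner_Integration.integral_sum set_integrable_mult_right[unfolded set_integrable_def]
          moments(1)[unfolded set_integrable_def])
    then have "(LINT t:{0<..}|lborel. p (exp (- t)) * g t) = 0"
      by (simp add: moments(2))
    then have "I = (LINT t:{0<..}|lborel. \<phi> (exp (- t)) * g t - p (exp (- t)) * g t)"
      by (simp add: set_integral_diff(2)[OF Nint pint] I_def)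
    also have "\<bar>\<dots>\<bar> \<le> (LINT t:{0<..}|lborel. \<bar>\<phi> (exp (- t)) * g t - p (exp (- t)) * g t\<bar>)"
      using set_integral_norm_bound[OF set_integral_diff(1)[OF Nint pint]] by simp
    also have "\<dots> \<le> (LINT t:{0<..}|lborel. e * \<bar>g t\<bar>)"
    proof (rule set_integral_mono)
      show "set_integrable lborel {0<..} (\<lambda>t. \<bar>\<phi> (exp (- t)) * g t - p (exp (- t)) * g t\<bar>)"
        by (intro set_integrable_abs set_integral_diff Nint pint)
      show "set_integrable lborel {0<..} (\<lambda>t. e * \<bar>g t\<bar>)"
        by (intro set_integrable_abs set_integrable_mult_right intg)
      show "\<bar>\<phi> (exp (- t)) * g t - p (exp (- t)) * g t\<bar> \<le> e * \<bar>g t\<bar>" if "t \<in> {0<..}" for t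
        using p(2)[of "exp (- t)"] that
        by (simp add: abs_mult mult_right_mono flip: left_diff_distrib)
    qed
    finally show ?thesis by simp
  qed
  define J where "J = (LINT t:{0<..}|lborel. \<bar>g t\<bar>)"
  have J: "J \<ge> 0" unfolding J_def set_lebesgue_integral_def by (intro integral_nonneg_AE) auto
  have "\<bar>I\<bar> \<le> 0"
  proof (rule field_le_epsilon)
    fix e :: real assume e: "e > 0"
    \<comment> \<open>\<open>J + 1\<close> in the denominator, since \<open>J\<close> may be
      0.\<close>
    have "\<bar>I\<bar> \<le> e / (J + 1) * J" using I_le[of "e / (J + 1)"] e J by (simp add: J_def)
    also have "\<dots> \<le> 0 + e" using e J by (simp add: field_simps)
    finally show "\<bar>I\<bar> \<le> 0 + e" .
  qed
  then have I0: "(LINT t|lborel. indicator {0<..} t *\<^sub>R (\<phi> (exp (- t)) * g t)) = 0"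
    by (simp add: I_def set_lebesgue_integral_def)
  \<comment> \<open>For \<open>t > 0\<close> the integrand is
    \<open>exp (- t) * (1 - exp (- t))\<close> times the square of \<open>g t\<close>.\<close>
  have pos: "AE t in lborel. 0 \<le> indicator {0<..} t *\<^sub>R (\<phi> (exp (- t)) * g t)"
    by (intro AE_I2) (auto simp: \<phi>_def indicator_def mult.assoc)
  have AE0: "AE t in lborel. indicator {0<..} t *\<^sub>R (\<phi> (exp (- t)) * g t) = 0"
    using integral_nonneg_eq_0_iff_AE[OF Nint[unfolded set_integrable_def] pos] I0 by simp
  \<comment> \<open>\<open>- V\<close> is closed and contains almost every positive number, hence
    all of them.\<close>
  define V where "V = {t \<in> {0<..}. a t \<noteq> 0}"
  have "V = {0<..} \<inter> a -` (- {0})" by (auto simp: V_def)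
  then have "open V"
    using continuous_open_preimage[OF exp_type_continuous[OF a]] by auto
  have "AE t in lborel. t \<in> {0<..} \<longrightarrow> t \<in> - V"
    using AE0 by eventually_elim (auto simp: V_def \<phi>_def g_def)
  then have "AE t in lebesgue. t \<in> {0<..} \<longrightarrow> t \<in> - V"
    by (rule AE_completion)
  then have "t \<in> - V"
    using mem_closed_if_AE_lebesgue_open[of "{0<..}" "- V" t] \<open>open V\<close> t by auto
  then show ?thesis using t by (auto simp: V_def)
qed

section \<open>Convolution of kernels in two variables\<close>

text \<open>
  With \<open>K r s = S r (u s)\<close> the diagonal integral below is the convolution \<open>(S * u)(t)\<close>. Applying a
  functional to it does not give a convolution of scalar functions, hence general kernels.
\<close>

definition exp_type2 :: "real \<Rightarrow> (real \<Rightarrow> real \<Rightarrow> 'a::real_normed_vector) \<Rightarrow> bool" where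
  "exp_type2 w K \<longleftrightarrow> continuous_on ({0<..} \<times> {0<..}) (\<lambda>(r, s). K r s) \<and>
     (\<exists>C. \<forall>r>0. \<forall>s>0. norm (K r s) \<le> C * exp (w * (r + s)))"

definition diag_conv :: "(real \<Rightarrow> real \<Rightarrow> real) \<Rightarrow> real \<Rightarrow> real" where
  "diag_conv K t = (LINT s:{0<..<t}|lborel. K (t - s) s)"

lemma exp_type2E:
  assumes "exp_type2 w K"
  obtains C where "C \<ge> 0" "\<And>r s. r > 0 \<Longrightarrow> s > 0 \<Longrightarrow> norm (K r s) \<le> C * exp (w * (r + s))"
proof -
  obtain C where C: "\<And>r s. r > 0 \<Longrightarrow> s > 0 \<Longrightarrow> norm (K r s) \<le> C * exp (w * (r + s))"
    using assms unfolding exp_type2_def by blast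
  have "0 \<le> C * exp (w * (1 + 1))" using order_trans[OF norm_ge_zero C[of 1 1]] by simp
  then have "C \<ge> 0" by (simp add: zero_le_mult_iff)
  with C that show thesis by blast
qed

lemma exp_type2_continuous_on:
  assumes "exp_type2 w K" "continuous_on A p" "continuous_on A q"
    and "\<And>z. z \<in> A \<Longrightarrow> p z > 0 \<and> q z > 0"
  shows "continuous_on A (\<lambda>z. K (p z) (q z))"
proof -
  have "continuous_on ({0<..} \<times> {0<..}) (\<lambda>(r, s). K r s)"
    using assms(1) by (simp add: exp_type2_def)
  from continuous_on_compose2[OF this continuous_on_Pair[OF assms(2,3)]] assms(4)
  show ?thesis by auto
qed

lemma exp_type2_bounded_linear:
  assumes "bounded_linear f" "exp_type2 w K"
  shows "exp_type2 w (\<lambda>r s. f (K r s))"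
proof -
  interpret bounded_linear f by fact
  obtain C where C: "C \<ge> 0" "\<And>r s. r > 0 \<Longrightarrow> s > 0 \<Longrightarrow> norm (K r s) \<le> C * exp (w * (r + s))"
    using exp_type2E[OF assms(2)] by blast
  obtain B where B: "B \<ge> 0" "\<And>x. norm (f x) \<le> norm x * B"
    using nonneg_bounded by blast
  have "continuous_on ({0<..} \<times> {0<..}) (\<lambda>z. f (K (fst z) (snd z)))"
    by (intro continuous_on exp_type2_continuous_on[OF assms(2)] continuous_intros) auto
  moreover have "norm (f (K r s)) \<le> (C * B) * exp (w * (r + s))" if "r > 0" "s > 0" for r s
    using mult_right_mono[OF C(2)[OF that] B(1)] B(2)[of "K r s"] by (simp add: algebra_simps)
  ultimately show ?thesis
    unfolding exp_type2_def by (auto simp: case_prod_beta)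
qed

text \<open>The bound in \<open>exp_type2\<close> depends on \<open>r + s\<close> alone, and this
  sum is \<open>t\<close> all along the path of integration.\<close>

lemma exp_type2_diag_bound:
  assumes "C \<ge> 0" "\<And>r s. r > 0 \<Longrightarrow> s > 0 \<Longrightarrow> norm (K r s) \<le> C * exp (w * (r + s))"
    and "s \<in> {0<..<t}"
  shows "norm (K (t - s) s) \<le> C * exp (w * t)"
  using assms(2)[of "t - s" s] assms(3) by simp

lemma exp_type2_diag_continuous:
  assumes "exp_type2 w K"
  shows "continuous_on {0<..<t} (\<lambda>s. K (t - s) s)"
  by (rule exp_type2_continuous_on[OF assms]) (auto intro!: continuous_intros)

lemma exp_type2_diag_integrable:
  fixes K :: "real \<Rightarrow> real \<Rightarrow> real"
  assumes "exp_type2 w K"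
  shows "set_integrable lborel {0<..<t} (\<lambda>s. K (t - s) s)"
proof -
  obtain C where C: "C \<ge> 0" "\<And>r s. r > 0 \<Longrightarrow> s > 0 \<Longrightarrow> norm (K r s) \<le> C * exp (w * (r + s))"
    using exp_type2E[OF assms] by blast
  have "set_integrable lborel {0<..<t} (\<lambda>s. C * exp (w * t))"
    by (rule set_integrable_subset[OF borel_integrable_atLeastAtMost'[of 0 t]]) auto
  then show ?thesis
  proof (rule set_integrable_bound)
    show "set_borel_measurable lborel {0<..<t} (\<lambda>s. K (t - s) s)"
      unfolding set_borel_measurable_def measurable_lborel2
      by (intro borel_measurable_continuous_on_indicator exp_type2_diag_continuous[OF assms]) auto
    show "AE s in lborel. s \<in> {0<..<t} \<longrightarrow> norm (K (t - s) s) \<le> norm (C * exp (w * t))"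
      using exp_type2_diag_bound[OF C] C(1) by (intro AE_I2) (auto simp: abs_mult)
  qed
qed

lemma exp_type2_integrable_on:
  fixes K :: "real \<Rightarrow> real \<Rightarrow> 'a::banach"
  assumes "exp_type2 w K"
  shows "(\<lambda>s. K (t - s) s) integrable_on {0..t}"
proof -
  obtain C where C: "C \<ge> 0" "\<And>r s. r > 0 \<Longrightarrow> s > 0 \<Longrightarrow> norm (K r s) \<le> C * exp (w * (r + s))"
    using exp_type2E[OF assms] by blast
  show ?thesis
    by (rule integrable_on_bounded_continuous[OF exp_type2_diag_continuous[OF assms] exp_type2_diag_bound[OF C]])
qed

text \<open>Bridge between the two integrals: the functional commutes with the gauge integral of the
  vector-valued kernel, and the resulting scalar integral is a Lebesgue integral, as the endpoints
  are negligible and the integrand is bounded.\<close>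

lemma bounded_linear_integral_diag:
  fixes K :: "real \<Rightarrow> real \<Rightarrow> 'a::banach" and f :: "'a \<Rightarrow> real"
  assumes f: "bounded_linear f" and K: "exp_type2 w K"
  shows "f (integral {0..t} (\<lambda>s. K (t - s) s)) = diag_conv (\<lambda>r s. f (K r s)) t"
proof -
  have "f (integral {0..t} (\<lambda>s. K (t - s) s)) = integral {0..t} (\<lambda>s. f (K (t - s) s))"
    using integral_linear[OF exp_type2_integrable_on[OF K] f] by (simp add: comp_def)
  also have "\<dots> = integral {0<..<t} (\<lambda>s. f (K (t - s) s))"
    by (simp add: integral_open_interval_real)
  also have "\<dots> = diag_conv (\<lambda>r s. f (K r s)) t"
    unfolding diag_conv_def
    by (rule set_borel_integral_eq_integral(2)[symmetric,
          OF exp_type2_diag_integrable[OF exp_type2_bounded_linear[OF f K]]])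
  finally show ?thesis .
qed

lemma diag_conv_bound:
  assumes "C \<ge> 0" "\<And>r s. r > 0 \<Longrightarrow> s > 0 \<Longrightarrow> norm (K r s) \<le> C * exp (w * (r + s))"
    and "exp_type2 w K" "t > 0"
  shows "(LINT s:{0<..<t}|lborel. \<bar>K (t - s) s\<bar>) \<le> C * (t * exp (w * t))"
proof -
  have "(LINT s:{0<..<t}|lborel. \<bar>K (t - s) s\<bar>) \<le> (LINT s:{0<..<t}|lborel. C * exp (w * t))"
  proof (rule set_integral_mono)
    show "set_integrable lborel {0<..<t} (\<lambda>s. \<bar>K (t - s) s\<bar>)"
      by (intro set_integrable_abs exp_type2_diag_integrable[OF assms(3)])
    show "set_integrable lborel {0<..<t} (\<lambda>s. C * exp (w * t))"
      by (rule set_integrable_subset[OF borel_integrable_atLeastAtMost'[of 0 t]]) auto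
  qed (use exp_type2_diag_bound[OF assms(1,2)] in auto)
  also have "\<dots> = C * (t * exp (w * t))"
    using assms(4) by (simp add: set_lebesgue_integral_def)
  finally show ?thesis .
qed

text \<open>The interval has length \<open>t\<close>, which costs one unit of growth. Continuity is
  dominated convergence over a fixed \<open>{0..B}\<close> that contains all intervals of the
  sequence.\<close>

lemma exp_type_diag_conv:
  assumes K: "exp_type2 w K" and w: "w \<ge> 0"
  shows "exp_type (w + 1) (diag_conv K)"
proof -
  obtain C where C: "C \<ge> 0" "\<And>r s. r > 0 \<Longrightarrow> s > 0 \<Longrightarrow> norm (K r s) \<le> C * exp (w * (r + s))"
    using exp_type2E[OF K] by blast
  show ?thesis
  proof (rule exp_typeI)
    show "norm (diag_conv K t) \<le> C * exp ((w + 1) * t)" if t: "t > 0" for t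
    proof -
      have "norm (diag_conv K t) \<le> (LINT s:{0<..<t}|lborel. norm (K (t - s) s))"
        unfolding diag_conv_def by (intro set_integral_norm_bound exp_type2_diag_integrable[OF K])
      also have "\<dots> \<le> C * (t * exp (w * t))"
        using diag_conv_bound[OF C K t] by simp
      also have "t \<le> exp t" using exp_ge_add_one_self[of t] by linarith
      then have "C * (t * exp (w * t)) \<le> C * exp ((w + 1) * t)"
        using C(1) by (intro mult_left_mono) (auto simp: algebra_simps exp_add)
      finally show ?thesis .
    qed
    show "continuous_on {0<..} (diag_conv K)"
      unfolding continuous_on_sequentially comp_def
    proof (intro allI ballI impI, elim conjE)
      fix X :: "nat \<Rightarrow> real" and t
      assume "t \<in> {0<..}" and X0: "\<forall>n. X n \<in> {0<..}" and X: "X \<longlonglongrightarrow> t"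
      then have t: "t > 0" by simp
      obtain B where B: "\<And>n. X n \<le> B"
        using convergent_imp_Bseq[OF convergentI[OF X]] unfolding Bseq_def
        by (metis abs_le_D1 real_norm_def)
      show "(\<lambda>n. diag_conv K (X n)) \<longlonglongrightarrow> diag_conv K t"
        unfolding diag_conv_def set_lebesgue_integral_def
      proof (rule integral_dominated_convergence)
        show "(\<lambda>s. indicator {0<..<t} s *\<^sub>R K (t - s) s) \<in> borel_measurable lborel" for t
          using exp_type2_diag_integrable[OF K] unfolding set_integrable_def
          by (rule borel_measurable_integrable)
        then show "(\<lambda>s. indicator {0<..<X n} s *\<^sub>R K (X n - s) s) \<in> borel_measurable lborel" for n .
        show "integrable lborel (\<lambda>s. indicator {0..B} s *\<^sub>R (C * exp (w * B)))"
          using borel_integrable_atLeastAtMost'[of 0 B "\<lambda>s. C * exp (w * B)"]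
          by (simp add: set_integrable_def)
        show "AE s in lborel. norm (indicator {0<..<X n} s *\<^sub>R K (X n - s) s)
            \<le> indicator {0..B} s *\<^sub>R (C * exp (w * B))" for n
        proof (intro AE_I2)
          fix s :: real
          show "norm (indicator {0<..<X n} s *\<^sub>R K (X n - s) s) \<le> indicator {0..B} s *\<^sub>R (C * exp (w * B))"
          proof (cases "s \<in> {0<..<X n}")
            case True
            have "norm (K (X n - s) s) \<le> C * exp (w * X n)"
              by (rule exp_type2_diag_bound[OF C True])
            also have "\<dots> \<le> C * exp (w * B)"
              using C(1) w B[of n] by (intro mult_left_mono) (auto intro: mult_left_mono)
            finally show ?thesis using True B[of n] by simp
          qed (use C(1) in auto)
        qed
        show "AE s in lborel. (\<lambda>n. indicator {0<..<X n} s *\<^sub>R K (X n - s) s)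
            \<longlonglongrightarrow> indicator {0<..<t} s *\<^sub>R K (t - s) s"
        \<comment> \<open>At \<open>s = t\<close> the indicators need not converge, so this single
          point is discarded as a null set.\<close>
        proof (rule AE_mp[OF AE_lborel_singleton[of t]], intro AE_I2 impI)
          fix s :: real assume "s \<noteq> t"
          then consider "s \<le> 0" | "t < s" | "0 < s" "s < t" by linarith
          then show "(\<lambda>n. indicator {0<..<X n} s *\<^sub>R K (X n - s) s)
            \<longlonglongrightarrow> indicator {0<..<t} s *\<^sub>R K (t - s) s"
          proof cases
            case 2
            then have "\<forall>\<^sub>F n in sequentially. X n < s" using X by (simp add: order_tendstoD)
            then have "\<forall>\<^sub>F n in sequentially. indicator {0<..<X n} s *\<^sub>R K (X n - s) s = 0"
              by eventually_elim auto
            then show ?thesis using 2 by (simp add: tendsto_eventually)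
          next
            case 3
            have ev: "\<forall>\<^sub>F n in sequentially. s < X n" using X 3 by (simp add: order_tendstoD)
            have "continuous_on {s<..} (\<lambda>z. K (z - s) s)"
              by (rule exp_type2_continuous_on[OF K]) (use 3 in \<open>auto intro!: continuous_intros\<close>)
            then have "isCont (\<lambda>z. K (z - s) s) t"
              using 3 by (simp add: continuous_on_eq_continuous_at)
            then have "(\<lambda>n. K (X n - s) s) \<longlonglongrightarrow> K (t - s) s"
              using X by (rule isCont_tendsto_compose)
            moreover have "\<forall>\<^sub>F n in sequentially. K (X n - s) s = indicator {0<..<X n} s *\<^sub>R K (X n - s) s"
              using ev by eventually_elim (use 3 in auto)
            ultimately have "(\<lambda>n. indicator {0<..<X n} s *\<^sub>R K (X n - s) s) \<longlonglongrightarrow> K (t - s) s"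
              by (rule Lim_transform_eventually)
            then show ?thesis using 3 by simp
          qed auto
        qed
      qed
    qed
  qed
qed

text \<open>Fubini over the wedge \<open>0 < s < t\<close> with the substitution
  \<open>t = s + r\<close>, under which \<open>exp (- (l * t))\<close> factors. For a product kernel
  this is the usual convolution theorem.\<close>

lemma laplace_diag_conv:
  assumes K: "exp_type2 w K" and l: "w + 1 < l"
  shows "laplace (diag_conv K) l = laplace (\<lambda>s. laplace (\<lambda>r. K r s) l) l"
proof -
  obtain C where C: "C \<ge> 0" "\<And>r s. r > 0 \<Longrightarrow> s > 0 \<Longrightarrow> norm (K r s) \<le> C * exp (w * (r + s))"
    using exp_type2E[OF K] by blast
  define P :: "(real \<times> real) set" where "P = {(t, s). 0 < s \<and> s < t}"
  define F where "F t s = indicator P (t, s) *\<^sub>R (exp (- (l * t)) * K (t - s) s)" for t s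
  have P: "open P"
    unfolding P_def case_prod_beta by (intro open_Collect_conj open_Collect_less continuous_intros)
  have F_slice: "F t s = exp (- (l * t)) * (indicator {0<..<t} s *\<^sub>R K (t - s) s)" for t s
    by (auto simp: F_def P_def indicator_def)
  have meas: "case_prod F \<in> borel_measurable (lborel \<Otimes>\<^sub>M lborel)"
  proof -
    have "(\<lambda>z. indicator P z *\<^sub>R (exp (- (l * fst z)) * K (fst z - snd z) (snd z))) \<in> borel_measurable borel"
      by (intro borel_measurable_continuous_on_indicator continuous_intros exp_type2_continuous_on[OF K])
        (use P in \<open>auto simp: P_def\<close>)
    then show ?thesis
      by (simp add: lborel_prod F_def case_prod_beta')
  qed
  have slice: "integrable lborel (F t)" for t
    unfolding F_slice using exp_type2_diag_integrable[OF K]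
    by (intro integrable_mult_right) (simp add: set_integrable_def)
  have "integrable (lborel \<Otimes>\<^sub>M lborel) (case_prod F)"
  proof (rule lborel_pair.Fubini_integrable[OF meas])
    \<comment> \<open>The majorant of the inner absolute integrals, from
      \<open>diag_conv_bound\<close>; its polynomial factor gives growth rate \<open>w + 1\<close>,
      which must lie below \<open>l\<close>.\<close>
    have "set_integrable lborel {0<..} (\<lambda>t. exp (- (l * t)) * (t * (C * exp (w * t))))"
      using l by (intro exp_type_set_integrable[OF exp_type_times_ident] exp_typeI[where C = C])
        (auto intro!: continuous_intros C simp: abs_mult C)
    then show "integrable lborel (\<lambda>t. \<integral>s. norm (case_prod F (t, s)) \<partial>lborel)"
      unfolding set_integrable_def
    proof (rule Bochner_Integration.integrable_bound)
      show "(\<lambda>t. \<integral>s. norm (case_prod F (t, s)) \<partial>lborel) \<in> borel_measurable lborel"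
        using meas by measurable
      have "(\<integral>s. norm (F t s) \<partial>lborel) \<le> exp (- (l * t)) * (t * (C * exp (w * t)))" if "t > 0" for t
      proof -
        have "(\<integral>s. norm (F t s) \<partial>lborel) = exp (- (l * t)) * (LINT s:{0<..<t}|lborel. \<bar>K (t - s) s\<bar>)"
          by (simp add: F_slice abs_mult set_lebesgue_integral_def)
        also have "\<dots> \<le> exp (- (l * t)) * (C * (t * exp (w * t)))"
          by (intro mult_left_mono diag_conv_bound[OF C K that]) auto
        finally show ?thesis by (simp add: ac_simps)
      qed
      moreover have "(\<integral>s. norm (F t s) \<partial>lborel) = 0" if "t \<le> 0" for t
        using that by (simp add: F_slice)
      ultimately show "AE t in lborel. norm (\<integral>s. norm (case_prod F (t, s)) \<partial>lborel)
          \<le> norm (indicator {0<..} t *\<^sub>R (exp (- (l * t)) * (t * (C * exp (w * t)))))"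
        using C(1) by (intro AE_I2) (auto simp: indicator_def abs_mult)
    qed
    show "AE t in lborel. integrable lborel (\<lambda>s. case_prod F (t, s))"
      using slice by simp
  qed
  then have swap: "(\<integral>s. (\<integral>t. F t s \<partial>lborel) \<partial>lborel) = (\<integral>t. (\<integral>s. F t s \<partial>lborel) \<partial>lborel)"
    by (rule lborel_pair.Fubini_integral)
  have "(\<integral>s. F t s \<partial>lborel) = indicator {0<..} t *\<^sub>R (exp (- (l * t)) * diag_conv K t)" for t
    by (cases "t > 0") (simp_all add: F_slice diag_conv_def set_lebesgue_integral_def)
  moreover have "(\<integral>t. F t s \<partial>lborel) = indicator {0<..} s *\<^sub>R (exp (- (l * s)) * laplace (\<lambda>r. K r s) l)" for s
  proof -
    have "(\<integral>t. F t s \<partial>lborel) = (\<integral>r. F (s + r) s \<partial>lborel)"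
      using lborel_integral_real_affine[of 1 "\<lambda>t. F t s" s] by simp
    also have "\<dots> = (\<integral>r. (indicator {0<..} s * exp (- (l * s))) * (indicator {0<..} r *\<^sub>R (exp (- (l * r)) * K r s)) \<partial>lborel)"
      by (intro Bochner_Integration.integral_cong)
        (auto simp: F_def P_def indicator_def algebra_simps exp_add exp_diff exp_minus field_simps)
    also have "\<dots> = indicator {0<..} s *\<^sub>R (exp (- (l * s)) * laplace (\<lambda>r. K r s) l)"
      by (simp add: laplace_def set_lebesgue_integral_def)
    finally show ?thesis .
  qed
  ultimately show ?thesis
    using swap by (simp add: laplace_def[of "diag_conv K"] laplace_def[of "\<lambda>s. laplace (\<lambda>r. K r s) l"] set_lebesgue_integral_def)
qed

section \<open>The kernels of convolution with g_1 and g_2\<close>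

lemma exp_type2I:
  assumes "continuous_on ({0<..} \<times> {0<..}) (\<lambda>z. K (fst z) (snd z))"
    and "\<And>r s. r > 0 \<Longrightarrow> s > 0 \<Longrightarrow> norm (K r s) \<le> C * exp (w * (r + s))"
  shows "exp_type2 w K"
  using assms unfolding exp_type2_def by (auto simp: case_prod_beta')

text \<open>A kernel that ignores \<open>r\<close> models convolution with g_1, that is, integration
  from 0 to \<open>t\<close>; \<open>w \<ge> 0\<close> supplies the growth in
  \<open>r\<close>.\<close>

lemma exp_type2_const:
  assumes a: "exp_type w a" and w: "w \<ge> 0"
  shows "exp_type2 w (\<lambda>r. a)"
proof -
  obtain C where C: "C \<ge> 0" "\<And>t. t > 0 \<Longrightarrow> norm (a t) \<le> C * exp (w * t)"
    using exp_typeE[OF a] by blast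
  show ?thesis
  proof (rule exp_type2I)
    show "continuous_on ({0<..} \<times> {0<..}) (\<lambda>z::real \<times> real. a (snd z))"
      by (rule continuous_on_compose2[OF exp_type_continuous[OF a]]) (auto intro!: continuous_intros)
    show "norm (a s) \<le> C * exp (w * (r + s))" if "r > 0" "s > 0" for r s
      using that w C(1) by (intro order_trans[OF C(2)] mult_left_mono) (auto simp: algebra_simps)
  qed
qed

text \<open>The kernel of convolution with g_2, whose value at \<open>t - s\<close> is
  \<open>r\<close>.\<close>

lemma exp_type2_scaleR:
  assumes a: "exp_type w a" and w: "w \<ge> 0"
  shows "exp_type2 (w + 1) (\<lambda>r s. r *\<^sub>R a s)"
proof -
  obtain C where C: "C \<ge> 0" "\<And>t. t > 0 \<Longrightarrow> norm (a t) \<le> C * exp (w * t)"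
    using exp_typeE[OF a] by blast
  show ?thesis
  proof (rule exp_type2I)
    show "continuous_on ({0<..} \<times> {0<..}) (\<lambda>z::real \<times> real. fst z *\<^sub>R a (snd z))"
      by (intro continuous_intros continuous_on_compose2[OF exp_type_continuous[OF a]]) auto
    show "norm (r *\<^sub>R a s) \<le> C * exp ((w + 1) * (r + s))" if rs: "r > 0" "s > 0" for r s
    proof -
      have "r \<le> exp r" using exp_ge_add_one_self[of r] by linarith
      then have "r * norm (a s) \<le> exp r * (C * exp (w * s))"
        using C(2)[OF rs(2)] rs by (intro mult_mono) auto
      also have "\<dots> = C * exp (r + w * s)" by (simp add: exp_add)
      also have "\<dots> \<le> C * exp ((w + 1) * (r + s))"
        using C(1) rs w by (intro mult_left_mono) (auto simp: algebra_simps)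
      finally show ?thesis using rs by simp
    qed
  qed
qed

lemma exp_type_integral:
  fixes a :: "real \<Rightarrow> 'a::banach"
  assumes a: "exp_type w a" and w: "w \<ge> 0"
  shows "exp_type (w + 1) (\<lambda>t. integral {0..t} a)"
proof -
  obtain C where C: "C \<ge> 0" "\<And>t. t > 0 \<Longrightarrow> norm (a t) \<le> C * exp (w * t)"
    using exp_typeE[OF a] by blast
  have int: "a integrable_on {0..t}" for t
    using exp_type2_integrable_on[OF exp_type2_const[OF a w]] .
  show ?thesis
  proof (rule exp_typeI)
    have "continuous (at t) (\<lambda>t. integral {0..t} a)" if "t > 0" for t
    proof -
      have "continuous_on {0<..<t + 1} (\<lambda>t. integral {0..t} a)"
        by (rule continuous_on_subset[OF indefinite_integral_continuous_1[OF int[of "t + 1"]]]) auto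
      then show ?thesis using that by (simp add: continuous_on_eq_continuous_at)
    qed
    then show "continuous_on {0<..} (\<lambda>t. integral {0..t} a)"
      by (simp add: continuous_on_eq_continuous_at)
    show "norm (integral {0..t} a) \<le> C * exp ((w + 1) * t)" if t: "t > 0" for t
    proof -
      have "norm (integral {0<..<t} a) \<le> integral {0<..<t} (\<lambda>s. C * exp (w * t))"
      proof (rule integral_norm_bound_integral)
        show "a integrable_on {0<..<t}" using int by (simp add: integrable_on_open_interval_real)
        show "(\<lambda>s. C * exp (w * t)) integrable_on {0<..<t}"
          unfolding integrable_on_open_interval_real by (rule integrable_const_ivl)
        show "norm (a s) \<le> C * exp (w * t)" if "s \<in> {0<..<t}" for s
          using that w C(1) by (intro order_trans[OF C(2)] mult_left_mono) (auto simp: mult_left_mono)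
      qed
      then have "norm (integral {0..t} a) \<le> C * (t * exp (w * t))"
        using t by (simp add: algebra_simps flip: integral_open_interval_real)
      also have "t \<le> exp t" using exp_ge_add_one_self[of t] by linarith
      then have "C * (t * exp (w * t)) \<le> C * exp ((w + 1) * t)"
        using C(1) by (intro mult_left_mono) (auto simp: algebra_simps exp_add)
      finally show ?thesis .
    qed
  qed
qed

lemma laplace_diag_conv_const:
  assumes "exp_type w a" "w \<ge> 0" "w + 1 < l"
  shows "laplace (diag_conv (\<lambda>r. a)) l = laplace a l / l"
proof -
  have "laplace (diag_conv (\<lambda>r. a)) l = laplace (\<lambda>s. (1 / l) * a s) l"
    using assms by (simp add: laplace_diag_conv[OF exp_type2_const] laplace_const)
  then show ?thesis by (simp only: laplace_cmult) simp
qed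

text \<open>\<open>t * c\<close> is the convolution of the constants 1 and \<open>c\<close>, so each
  of them contributes one factor \<open>1 / l\<close>.\<close>

lemma laplace_linear:
  assumes "1 < l"
  shows "laplace (\<lambda>t. t * c) l = c / l\<^sup>2"
proof -
  have "laplace (\<lambda>t. t * c) l = laplace (diag_conv (\<lambda>r s. c)) l"
    by (rule laplace_cong) (simp add: diag_conv_def set_lebesgue_integral_def)
  also have "\<dots> = laplace (\<lambda>t. c) l / l"
    using assms by (intro laplace_diag_conv_const[where w = 0] exp_typeI[where C = "\<bar>c\<bar>"]) auto
  finally show ?thesis using assms by (simp add: laplace_const power2_eq_square)
qed

lemma laplace_diag_conv_scaleR:
  fixes a :: "real \<Rightarrow> real"
  assumes "exp_type w a" "w \<ge> 0" "w + 2 < l"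
  shows "laplace (diag_conv (\<lambda>r s. r *\<^sub>R a s)) l = laplace a l / l\<^sup>2"
proof -
  have "laplace (diag_conv (\<lambda>r s. r *\<^sub>R a s)) l = laplace (\<lambda>s. laplace (\<lambda>r. r *\<^sub>R a s) l) l"
    using assms(3) by (intro laplace_diag_conv[OF exp_type2_scaleR[OF assms(1,2)]]) simp
  also have "\<dots> = laplace (\<lambda>s. (1 / l\<^sup>2) * a s) l"
    using assms(2,3) by (simp add: laplace_linear)
  finally have "laplace (diag_conv (\<lambda>r s. r *\<^sub>R a s)) l = laplace (\<lambda>s. (1 / l\<^sup>2) * a s) l" .
  then show ?thesis by (simp only: laplace_cmult) simp
qed

section \<open>Families whose Laplace transform is a resolvent\<close>

text \<open>For \<open>a = R(\<nu>) x\<close> one has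
  \<open>(\<mu> - A) a = x - (\<nu> - \<mu>) a\<close>, and \<open>R(\<mu>)\<close> is applied to
  this. The scalar stays inside \<open>R(\<mu>)\<close>, for which \<open>resolvent_set\<close>
  asserts real linearity only; real scalars are pulled out later.\<close>

lemma resolvent_identity:
  assumes "\<mu> \<in> resolvent_set D A" "\<nu> \<in> resolvent_set D A"
  shows "resolvent_op D A \<mu> x - resolvent_op D A \<nu> x
    = resolvent_op D A \<mu> ((\<nu> - \<mu>) *\<^sub>C resolvent_op D A \<nu> x)"
proof -
  have inj: "bij_betw (\<lambda>x. \<mu> *\<^sub>C x - A x) D UNIV" "bij_betw (\<lambda>x. \<nu> *\<^sub>C x - A x) D UNIV"
    and lin: "bounded_linear (resolvent_op D A \<mu>)"
    using assms by (auto simp: resolvent_set_def)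
  define a where "a = resolvent_op D A \<nu> x"
  have a: "a \<in> D" "\<nu> *\<^sub>C a - A a = x"
    using bij_betw_inv_into_right[OF inj(2), of x] bij_betwE[OF bij_betw_inv_into[OF inj(2)]]
    by (auto simp: a_def resolvent_op_def)
  have "\<mu> *\<^sub>C a = \<nu> *\<^sub>C a + (\<mu> - \<nu>) *\<^sub>C a"
    by (simp flip: scaleC_add_left)
  \<comment> \<open>The law for the scalar 0 is not among the axioms of
    \<open>complex_banach\<close>; it comes from \<open>scaleC_of_real\<close>.\<close>
  moreover have "(\<mu> - \<nu>) *\<^sub>C a + (\<nu> - \<mu>) *\<^sub>C a = 0"
    using scaleC_of_real[of 0 a] by (simp flip: scaleC_add_left)
  ultimately have "\<mu> *\<^sub>C a - A a = x - (\<nu> - \<mu>) *\<^sub>C a"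
    using a(2) by (simp add: algebra_simps add_eq_0_iff2)
  then have "a = resolvent_op D A \<mu> (x - (\<nu> - \<mu>) *\<^sub>C a)"
    using bij_betw_inv_into_left[OF inj(1) a(1)] by (simp add: resolvent_op_def)
  also have "\<dots> = resolvent_op D A \<mu> x - resolvent_op D A \<mu> ((\<nu> - \<mu>) *\<^sub>C a)"
    by (rule linear_diff[OF bounded_linear.linear[OF lin]])
  finally show ?thesis
    unfolding a_def[symmetric] by (metis add_diff_cancel_left' diff_add_cancel)
qed

text \<open>\<open>Q l\<close> stands for \<open>(l\<^sup>\<alpha> - A)\<^sup>-\<^sup>1\<close>; of \<open>A\<close> only the resolvent identity is needed.\<close>

locale resolvent_transform =
  fixes S :: "real \<Rightarrow> 'a::complex_banach \<Rightarrow>\<^sub>L 'a" and Q :: "real \<Rightarrow> 'a \<Rightarrow> 'a"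
    and \<alpha> M w L :: real
  assumes S_cont: "continuous_on {0<..} (\<lambda>t. blinfun_apply (S t) x)"
    and S_bound: "t > 0 \<Longrightarrow> norm (S t) \<le> M * exp (w * t)"
    and w: "w \<ge> 0" and L: "w + 3 \<le> L"
    and Q_linear: "L < l \<Longrightarrow> bounded_linear (Q l)"
    and Q_identity: "L < l \<Longrightarrow> L < m \<Longrightarrow> Q l x - Q m x = (m powr \<alpha> - l powr \<alpha>) *\<^sub>R Q l (Q m x)"
    and Q_laplace: "L < l \<Longrightarrow>
      ((\<lambda>t. exp (- (l * t)) *\<^sub>R blinfun_apply (S t) x) has_integral l powr (\<alpha> - 1) *\<^sub>R Q l x) {0<..}"
begin

definition H :: "real \<Rightarrow> 'a \<Rightarrow> 'a" where
  "H l x = l powr (\<alpha> - 1) *\<^sub>R Q l x"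

lemma M_nonneg: "M \<ge> 0"
proof -
  have "0 \<le> M * exp (w * 1)" using order_trans[OF norm_ge_zero S_bound[of 1]] by simp
  then show ?thesis by (simp add: zero_le_mult_iff)
qed

lemma H_linear: "L < l \<Longrightarrow> bounded_linear (H l)"
  unfolding H_def by (intro bounded_linear_const_scaleR Q_linear)

lemma S_exp_type: "exp_type w (\<lambda>t. blinfun_apply (S t) x)"
proof (rule exp_typeI[OF S_cont])
  show "norm (S t x) \<le> (M * norm x) * exp (w * t)" if "t > 0" for t
    using order_trans[OF norm_blinfun mult_right_mono[OF S_bound[OF that] norm_ge_zero]]
    by (simp add: ac_simps)
qed

lemma laplace_S:
  assumes f: "bounded_linear f" and l: "L < l"
  shows "laplace (\<lambda>t. f (blinfun_apply (S t) x)) l = f (H l x)"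
proof (rule laplace_eq_has_integral[OF exp_type_bounded_linear[OF f S_exp_type]])
  show "w < l" using L l by linarith
  show "((\<lambda>t. exp (- (l * t)) * f (S t x)) has_integral f (H l x)) {0<..}"
    using has_integral_linear[OF Q_laplace[OF l] f]
    by (simp add: comp_def H_def linear_cmul[OF bounded_linear.linear[OF f]])
qed

text \<open>By \<open>Q_identity\<close> the difference quotient is that of
  \<open>l powr \<alpha>\<close> times \<open>- f (Q m (Q l x))\<close>. Its limit needs only weak
  continuity of \<open>Q m\<close> on the fixed vector \<open>Q l x\<close>, which is inherited from
  the differentiable scalar transform of the family; no operator-norm continuity of the resolvent is
  involved.\<close>

lemma Q_derivative:
  assumes f: "bounded_linear f" and l: "L < l"
  shows "((\<lambda>l. f (Q l x)) has_real_derivative - (\<alpha> * l powr (\<alpha> - 1) * f (Q l (Q l x)))) (at l)"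
proof -
  have l0: "l > 0" using l L w by linarith
  have ev: "\<forall>\<^sub>F m in at l. m \<in> {L<..}" 
    using l by (intro eventually_at_in_open') auto
  \<comment> \<open>The power undoes the factor in \<open>H\<close>, so for \<open>m > L\<close>
    this function is \<open>f (Q m (Q l x))\<close>.\<close>
  have "isCont (\<lambda>m. m powr (1 - \<alpha>) * laplace (\<lambda>t. f (S t (Q l x))) m) l"
  proof (intro continuous_intros)
    show "isCont (laplace (\<lambda>t. f (S t (Q l x)))) l"
      using l L by (intro DERIV_isCont[OF laplace_has_real_derivative[OF exp_type_bounded_linear[OF f S_exp_type]]]) auto
  qed (use l0 in auto)
  moreover have eq: "m powr (1 - \<alpha>) * laplace (\<lambda>t. f (S t (Q l x))) m = f (Q m (Q l x))"
    if "L < m" for m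
    using that L w by (simp add: laplace_S[OF f] H_def linear_cmul[OF bounded_linear.linear[OF f]]
        flip: powr_add mult.assoc)
  ultimately have "((\<lambda>m. m powr (1 - \<alpha>) * laplace (\<lambda>t. f (S t (Q l x))) m) \<longlongrightarrow> f (Q l (Q l x))) (at l)"
    using l by (simp add: isCont_def)
  moreover have "\<forall>\<^sub>F m in at l. m powr (1 - \<alpha>) * laplace (\<lambda>t. f (S t (Q l x))) m = f (Q m (Q l x))"
    using ev by eventually_elim (simp add: eq)
  ultimately have lim: "((\<lambda>m. f (Q m (Q l x))) \<longlongrightarrow> f (Q l (Q l x))) (at l)"
    by (rule Lim_transform_eventually)
  have "((\<lambda>m. m powr \<alpha>) has_real_derivative \<alpha> * l powr (\<alpha> - 1)) (at l)"
    using l0 by (auto intro!: derivative_eq_intros)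
  then have "((\<lambda>m. (m powr \<alpha> - l powr \<alpha>) / (m - l)) \<longlongrightarrow> \<alpha> * l powr (\<alpha> - 1)) (at l)"
    by (simp add: has_field_derivative_iff)
  then have "((\<lambda>m. - ((m powr \<alpha> - l powr \<alpha>) / (m - l) * f (Q m (Q l x)))) \<longlongrightarrow>
      - (\<alpha> * l powr (\<alpha> - 1) * f (Q l (Q l x)))) (at l)"
    by (intro tendsto_intros lim)
  moreover have "\<forall>\<^sub>F m in at l. - ((m powr \<alpha> - l powr \<alpha>) / (m - l) * f (Q m (Q l x)))
      = (f (Q m x) - f (Q l x)) / (m - l)"
    using ev
  proof eventually_elim
    case (elim m)
    have "f (Q m x) - f (Q l x) = (l powr \<alpha> - m powr \<alpha>) * f (Q m (Q l x))"
      using elim l by (simp add: Q_identity linear_cmul[OF bounded_linear.linear[OF f]]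
          flip: linear_diff[OF bounded_linear.linear[OF f]])
    then show ?case by (simp only:) (simp add: algebra_simps diff_divide_distrib)
  qed
  ultimately show ?thesis
    unfolding has_field_derivative_iff by (rule Lim_transform_eventually)
qed

text \<open>Product rule: of the two powers \<open>l powr (\<alpha> - 1)\<close> at the double
  resolvent, one comes from \<open>H\<close> and one from differentiating
  \<open>l powr \<alpha>\<close>; together they complete \<open>H l (H l x)\<close>.\<close>

lemma H_derivative:
  assumes f: "bounded_linear f" and l: "L < l"
  shows "((\<lambda>l. f (H l x)) has_real_derivative (\<alpha> - 1) / l * f (H l x) - \<alpha> * f (H l (H l x))) (at l)"
proof -
  have l0: "l > 0" using l L w by linarith
  note lf = linear_cmul[OF bounded_linear.linear[OF f]]
  have fH: "(\<lambda>l. f (H l x)) = (\<lambda>l. l powr (\<alpha> - 1) * f (Q l x))"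
    by (simp add: H_def lf)
  have fHH: "f (H l (H l x)) = l powr (\<alpha> - 1) * (l powr (\<alpha> - 1) * f (Q l (Q l x)))"
    by (simp add: H_def lf linear_cmul[OF bounded_linear.linear[OF Q_linear[OF l]]])
  have pw: "l powr (\<alpha> - 1 - 1) = l powr (\<alpha> - 1) / l"
    by (subst powr_diff) (use l0 in simp)
  have "((\<lambda>l. l powr (\<alpha> - 1) * f (Q l x)) has_real_derivative
      (\<alpha> - 1) * l powr (\<alpha> - 1 - 1) * f (Q l x)
        + - (\<alpha> * l powr (\<alpha> - 1) * f (Q l (Q l x))) * l powr (\<alpha> - 1)) (at l)"
    using l0 by (intro DERIV_mult Q_derivative[OF f l]) (auto intro!: derivative_eq_intros)
  moreover have "(\<alpha> - 1) * l powr (\<alpha> - 1 - 1) * f (Q l x)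
        + - (\<alpha> * l powr (\<alpha> - 1) * f (Q l (Q l x))) * l powr (\<alpha> - 1)
      = (\<alpha> - 1) / l * f (H l x) - \<alpha> * f (H l (H l x))"
    unfolding fHH pw fun_cong[OF fH, of l] by simp
  ultimately show ?thesis unfolding fH by simp
qed

section \<open>Transforms of the solution and of the terms of the identity\<close>

context
  fixes x y :: 'a
begin

abbreviation "u \<equiv> cauchy_solution S x y"

lemma u_eq: "u t = S t x + integral {0..t} (\<lambda>s. S s y)"
  by (simp add: cauchy_solution_def finite_conv_def gker_1)

lemma u_exp_type: "exp_type (w + 1) u"
  unfolding u_eq
  by (intro exp_type_add exp_type_integral S_exp_type w exp_type_mono[OF S_exp_type]) simp

lemma laplace_u:
  assumes f: "bounded_linear f" and l: "L < l"
  shows "laplace (\<lambda>t. f (u t)) l = f (H l x) + f (H l y) / l"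
proof -
  have fS: "exp_type w (\<lambda>t. f (S t z))" for z
    by (rule exp_type_bounded_linear[OF f S_exp_type])
  have "f (u t) = f (S t x) + diag_conv (\<lambda>r s. f (S s y)) t" for t
    using bounded_linear_integral_diag[OF f exp_type2_const[OF S_exp_type w]]
    by (simp add: u_eq linear_add[OF bounded_linear.linear[OF f]])
  then have "laplace (\<lambda>t. f (u t)) l
      = laplace (\<lambda>t. f (S t x)) l + laplace (diag_conv (\<lambda>r s. f (S s y))) l"
    using l L by (simp add: laplace_add[OF exp_type_mono[OF fS] exp_type_diag_conv[OF exp_type2_const[OF fS w] w]])
  also have "\<dots> = f (H l x) + f (H l y) / l"
    using l L by (simp add: laplace_diag_conv_const[OF fS w] laplace_S[OF f])
  finally show ?thesis .
qed

text \<open>Minus the derivative of \<open>laplace_u\<close>; the last summand stems from the factor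
  \<open>1 / l\<close> at \<open>y\<close>.\<close>

lemma laplace_times_u:
  assumes f: "bounded_linear f" and l: "L < l"
  shows "laplace (\<lambda>t. t * f (u t)) l
    = \<alpha> * f (H l (H l x)) - (\<alpha> - 1) / l * f (H l x)
      + (\<alpha> * f (H l (H l y)) - (\<alpha> - 1) / l * f (H l y)) / l + f (H l y) / l\<^sup>2"
proof -
  have l0: "l > 0" using l L w by linarith
  have "((\<lambda>l. f (H l x) + f (H l y) / l) has_real_derivative
      ((\<alpha> - 1) / l * f (H l x) - \<alpha> * f (H l (H l x)))
      + (((\<alpha> - 1) / l * f (H l y) - \<alpha> * f (H l (H l y))) * l - f (H l y) * 1) / (l * l)) (at l)"
    using l0 by (intro DERIV_add DERIV_divide H_derivative[OF f l] DERIV_ident) auto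
  then have "(laplace (\<lambda>t. f (u t)) has_real_derivative
      ((\<alpha> - 1) / l * f (H l x) - \<alpha> * f (H l (H l x)))
      + (((\<alpha> - 1) / l * f (H l y) - \<alpha> * f (H l (H l y))) * l - f (H l y) * 1) / (l * l)) (at l)"
    by (rule has_field_derivative_transform_within_open[where S = "{L<..}"])
      (use l laplace_u[OF f] in auto)
  moreover have "(laplace (\<lambda>t. f (u t)) has_real_derivative - laplace (\<lambda>t. t * f (u t)) l) (at l)"
    using l L by (intro laplace_has_real_derivative[OF exp_type_bounded_linear[OF f u_exp_type]]) auto
  ultimately have "- laplace (\<lambda>t. t * f (u t)) l = ((\<alpha> - 1) / l * f (H l x) - \<alpha> * f (H l (H l x)))
      + (((\<alpha> - 1) / l * f (H l y) - \<alpha> * f (H l (H l y))) * l - f (H l y) * 1) / (l * l)"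
    by (rule DERIV_unique[rotated])
  then have "laplace (\<lambda>t. t * f (u t)) l = - (((\<alpha> - 1) / l * f (H l x) - \<alpha> * f (H l (H l x)))
      + (((\<alpha> - 1) / l * f (H l y) - \<alpha> * f (H l (H l y))) * l - f (H l y) * 1) / (l * l))"
    by (simp only: minus_equation_iff)
  also have "\<dots> = \<alpha> * f (H l (H l x)) - (\<alpha> - 1) / l * f (H l x)
      + (\<alpha> * f (H l (H l y)) - (\<alpha> - 1) / l * f (H l y)) / l + f (H l y) / l\<^sup>2"
    using l0 by (simp add: field_simps power2_eq_square)
  finally show ?thesis .
qed

text \<open>Joint continuity at a point with second coordinate \<open>s0\<close> follows from
  \<open>S r (u s) = S r (u s - u s0) + S r (u s0)\<close>: the bound on \<open>norm (S r)\<close>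
  handles the first term, strong continuity at the fixed vector \<open>u s0\<close> the
  second.\<close>

lemma conv_S_u_exp_type2: "exp_type2 (w + 1) (\<lambda>r s. blinfun_apply (S r) (u s))"
proof -
  obtain C where C: "C \<ge> 0" "\<And>t. t > 0 \<Longrightarrow> norm (u t) \<le> C * exp ((w + 1) * t)"
    using exp_typeE[OF u_exp_type] by blast
  show ?thesis
  proof (rule exp_type2I)
    show "norm (S r (u s)) \<le> (M * C) * exp ((w + 1) * (r + s))" if rs: "r > 0" "s > 0" for r s
    proof -
      have "norm (S r (u s)) \<le> (M * exp (w * r)) * (C * exp ((w + 1) * s))"
        by (intro order_trans[OF norm_blinfun] mult_mono S_bound C rs mult_nonneg_nonneg M_nonneg) auto
      also have "\<dots> = (M * C) * exp (w * r + (w + 1) * s)" by (simp add: exp_add)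
      also have "\<dots> \<le> (M * C) * exp ((w + 1) * (r + s))"
        using M_nonneg C(1) rs by (intro mult_left_mono) (auto simp: algebra_simps)
      finally show ?thesis .
    qed
    show "continuous_on ({0<..} \<times> {0<..}) (\<lambda>z. S (fst z) (u (snd z)))"
      unfolding continuous_on_sequentially comp_def
    proof (intro allI ballI impI, elim conjE)
      fix X :: "nat \<Rightarrow> real \<times> real" and z
      assume z: "z \<in> {0<..} \<times> {0<..}" and X: "\<forall>n. X n \<in> {0<..} \<times> {0<..}" "X \<longlonglongrightarrow> z"
      have pos: "fst (X n) > 0" "snd (X n) > 0" for n using X(1)[rule_format, of n] by auto
      have lim: "(\<lambda>n. fst (X n)) \<longlonglongrightarrow> fst z" "(\<lambda>n. snd (X n)) \<longlonglongrightarrow> snd z"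
        using X(2) by (auto intro: tendsto_intros)
      have limu: "(\<lambda>n. u (snd (X n))) \<longlonglongrightarrow> u (snd z)"
        using continuous_on_tendsto_compose[OF exp_type_continuous[OF u_exp_type] lim(2)] z pos by auto
      have limS: "(\<lambda>n. S (fst (X n)) (u (snd z))) \<longlonglongrightarrow> S (fst z) (u (snd z))"
        using continuous_on_tendsto_compose[OF S_cont lim(1)] z pos by auto
      have "(\<lambda>n. (M * exp (w * fst (X n))) * norm (u (snd (X n)) - u (snd z)))
          \<longlonglongrightarrow> (M * exp (w * fst z)) * norm (u (snd z) - u (snd z))"
        by (intro tendsto_intros lim limu)
      then have "(\<lambda>n. (M * exp (w * fst (X n))) * norm (u (snd (X n)) - u (snd z))) \<longlonglongrightarrow> 0"
        by simp
      then have "(\<lambda>n. S (fst (X n)) (u (snd (X n)) - u (snd z))) \<longlonglongrightarrow> 0"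
      proof (rule Lim_null_comparison[rotated])
        show "\<forall>\<^sub>F n in sequentially. norm (S (fst (X n)) (u (snd (X n)) - u (snd z)))
            \<le> (M * exp (w * fst (X n))) * norm (u (snd (X n)) - u (snd z))"
          by (intro always_eventually allI order_trans[OF norm_blinfun] mult_right_mono S_bound pos) auto
      qed
      from tendsto_add[OF this limS]
      show "(\<lambda>n. S (fst (X n)) (u (snd (X n)))) \<longlonglongrightarrow> S (fst z) (u (snd z))"
        by (simp add: blinfun.diff_right)
    qed
  qed
qed

text \<open>The inner transform over \<open>r\<close> turns \<open>f (S r (u s))\<close> into
  \<open>f (H l (u s))\<close>. Since \<open>f\<close> composed with \<open>H l\<close> is again a
  bounded functional, \<open>laplace_u\<close> applies with it in place of \<open>f\<close>.\<close>

lemma laplace_conv_S_u: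
  assumes f: "bounded_linear f" and l: "L < l"
  shows "laplace (diag_conv (\<lambda>r s. f (blinfun_apply (S r) (u s)))) l
    = f (H l (H l x)) + f (H l (H l y)) / l"
proof -
  have "laplace (diag_conv (\<lambda>r s. f (S r (u s)))) l = laplace (\<lambda>s. f (H l (u s))) l"
    using l L
    by (simp add: laplace_diag_conv[OF exp_type2_bounded_linear[OF f conv_S_u_exp_type2]] laplace_S[OF f])
  also have "\<dots> = f (H l (H l x)) + f (H l (H l y)) / l"
    using laplace_u[OF bounded_linear_compose[OF f H_linear[OF l]] l] by simp
  finally show ?thesis .
qed

lemma functional_identity:
  assumes f: "bounded_linear f" and t: "t > 0"
  shows "t * f (u t) - diag_conv (\<lambda>r s. f (u s)) t - diag_conv (\<lambda>r s. f (r *\<^sub>R blinfun_apply (S s) y)) t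
    = \<alpha> * (diag_conv (\<lambda>r s. f (blinfun_apply (S r) (u s))) t - diag_conv (\<lambda>r s. f (u s)) t)"
proof -
  let ?a = "\<lambda>t. t * f (u t)"
  let ?b = "diag_conv (\<lambda>r s. f (u s))"
  let ?c = "diag_conv (\<lambda>r s. f (r *\<^sub>R S s y))"
  let ?d = "diag_conv (\<lambda>r s. f (S r (u s)))"
  have fS: "exp_type w (\<lambda>t. f (S t y))"
    by (rule exp_type_bounded_linear[OF f S_exp_type])
  have fu: "exp_type (w + 1) (\<lambda>t. f (u t))"
    by (rule exp_type_bounded_linear[OF f u_exp_type])
  have c_eq: "(\<lambda>r s. f (r *\<^sub>R S s y)) = (\<lambda>r s. r *\<^sub>R f (S s y))"
    by (simp add: linear_cmul[OF bounded_linear.linear[OF f]])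
  have a: "exp_type (w + 2) ?a"
    using exp_type_times_ident[OF fu] by (simp add: add.assoc)
  have b: "exp_type (w + 2) ?b"
    using exp_type_diag_conv[OF exp_type2_const[OF fu]] w by (simp add: add.assoc)
  have c: "exp_type (w + 2) ?c"
    using exp_type_diag_conv[OF exp_type2_scaleR[OF fS w]] w by (simp add: c_eq add.assoc)
  have d: "exp_type (w + 2) ?d"
    using exp_type_diag_conv[OF exp_type2_bounded_linear[OF f conv_S_u_exp_type2]] w
    by (simp add: add.assoc)
  have "(?a t - ?b t - ?c t) - \<alpha> * (?d t - ?b t) = 0"
  proof (rule laplace_zero_imp_zero[where L = L and t = t
        and a = "\<lambda>t. (?a t - ?b t - ?c t) - \<alpha> * (?d t - ?b t)"])
    show "exp_type (w + 2) (\<lambda>t. (?a t - ?b t - ?c t) - \<alpha> * (?d t - ?b t))"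
      by (intro exp_type_diff exp_type_cmult a b c d)
    show "laplace (\<lambda>t. (?a t - ?b t - ?c t) - \<alpha> * (?d t - ?b t)) l = 0" if l: "L < l" for l
    proof -
      have l': "w + 2 < l" "l > 0" using l L w by linarith+
      have B: "laplace ?b l = (f (H l x) + f (H l y) / l) / l"
        using laplace_diag_conv_const[OF fu, of l] laplace_u[OF f l] l' w by simp
      have C: "laplace ?c l = f (H l y) / l\<^sup>2"
        unfolding c_eq using laplace_diag_conv_scaleR[OF fS w l'(1)] laplace_S[OF f l] by simp
      have "laplace (\<lambda>t. (?a t - ?b t - ?c t) - \<alpha> * (?d t - ?b t)) l
          = laplace ?a l - laplace ?b l - laplace ?c l - \<alpha> * (laplace ?d l - laplace ?b l)"
        by (simp only: laplace_diff[OF exp_type_diff[OF exp_type_diff[OF a b] c] exp_type_cmult[OF exp_type_diff[OF d b]] l'(1)]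
            laplace_diff[OF exp_type_diff[OF a b] c l'(1)] laplace_diff[OF a b l'(1)]
            laplace_diff[OF d b l'(1)] laplace_cmult)
      also have "\<dots> = 0"
        unfolding laplace_times_u[OF f l] laplace_conv_S_u[OF f l] B C
        using l'(2) by (simp add: field_simps power2_eq_square)
      finally show ?thesis .
    qed
  qed (rule t)
  then show ?thesis by simp
qed

lemma solution_identity:
  assumes t: "t > 0"
  shows "t *\<^sub>R u t - conv_scalar (gker 1) u t - conv_scalar (gker 2) (\<lambda>s. blinfun_apply (S s) y) t
    = \<alpha> *\<^sub>R phi S x y t"
proof (rule ccontr)
  let ?d = "t *\<^sub>R u t - conv_scalar (gker 1) u t - conv_scalar (gker 2) (\<lambda>s. S s y) t - \<alpha> *\<^sub>R phi S x y t"
  assume "\<not> ?thesis"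
  then have "?d \<noteq> 0" by simp
  then obtain f :: "'a \<Rightarrow> real" where f: "bounded_linear f" and nz: "f ?d \<noteq> 0"
    using exists_bounded_linear_functional by blast
  interpret f: bounded_linear f by (rule f)
  have g1: "f (conv_scalar (gker 1) u t) = diag_conv (\<lambda>r s. f (u s)) t"
    using bounded_linear_integral_diag[OF f exp_type2_const[OF u_exp_type]] w
    by (simp add: finite_conv_def gker_1)
  \<comment> \<open>\<open>gker_2\<close> needs a nonnegative argument, which \<open>t - s\<close>
    is on the range of integration.\<close>
  have "conv_scalar (gker 2) (\<lambda>s. S s y) t = integral {0..t} (\<lambda>s. (t - s) *\<^sub>R S s y)"
    unfolding finite_conv_def by (rule integral_cong) (simp add: gker_2)
  then have g2: "f (conv_scalar (gker 2) (\<lambda>s. S s y) t) = diag_conv (\<lambda>r s. f (r *\<^sub>R S s y)) t"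
    using bounded_linear_integral_diag[OF f exp_type2_scaleR[OF S_exp_type w]] by simp
  have S: "f (conv_op S u t) = diag_conv (\<lambda>r s. f (S r (u s))) t"
    using bounded_linear_integral_diag[OF f conv_S_u_exp_type2] by (simp add: finite_conv_def)
  have "f ?d = 0"
    using functional_identity[OF f t]
    by (simp add: f.diff f.scaleR phi_def g1 g2 S)
  with nz show False by contradiction
qed

end

end

theorem theorem15:
  fixes A :: "'a::complex_banach \<Rightarrow> 'a"
    and D :: "'a set"
    and S :: "real \<Rightarrow> 'a \<Rightarrow>\<^sub>L 'a"
    and \<alpha> T :: real
    and x y :: 'a
  assumes "1 < \<alpha>" and "\<alpha> < 2"
    and "closed_linear_operator D A"
    and "resolvent_family \<alpha> 1 D A S"
    and "T > 0"
  shows "T *\<^sub>R cauchy_solution S x y T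
           - conv_scalar (gker 1) (cauchy_solution S x y) T
           - conv_scalar (gker 2) (\<lambda>s. blinfun_apply (S s) y) T
         = \<alpha> *\<^sub>R phi S x y T"
proof -
  note S = assms(4)[unfolded resolvent_family_def]
  have cont: "continuous_on {0<..} (\<lambda>t. S t x)" for x
    using S by blast
  have "\<exists>M>0. \<exists>w. \<forall>t>0. norm (S t) \<le> M * exp (w * t)"
    using S by (elim conjE)
  then obtain M w where M: "M > 0" and bound: "\<And>t. t > 0 \<Longrightarrow> norm (S t) \<le> M * exp (w * t)"
    by blast
  from S obtain \<omega> where \<omega>: "\<omega> \<ge> 0"
    and res: "{z powr complex_of_real \<alpha> | z. Re z > \<omega>} \<subseteq> resolvent_set D A"
    and lap': "\<forall>x z. Re z > \<omega> \<longrightarrow>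
      ((\<lambda>t. exp (- z * complex_of_real t) *\<^sub>C S t x) has_integral
        (z powr complex_of_real (\<alpha> - 1)) *\<^sub>C resolvent_op D A (z powr complex_of_real \<alpha>) x) {0<..}"
    by (elim conjE exE)
  note lap = lap'[rule_format]
  \<comment> \<open>The rate \<open>w\<close> may be negative, while the bounds on convolutions use
    a nonnegative one.\<close>
  define w' where "w' = max w 0"
  \<comment> \<open>Beyond \<open>\<omega>\<close>, so that \<open>l powr \<alpha>\<close> lies in
    the resolvent set for \<open>l > L\<close>; \<open>w' + 3\<close> is the margin demanded by
    \<open>resolvent_transform\<close>.\<close>
  define L where "L = max \<omega> (w' + 3)"
  define Q where "Q l = resolvent_op D A (complex_of_real (l powr \<alpha>))" for l :: real
  have pos: "l > 0" "l > \<omega>" if "L < l" for l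
    using that \<omega> by (auto simp: L_def)
  have powr: "complex_of_real l powr complex_of_real p = complex_of_real (l powr p)" if "L < l" for l p
    using pos[OF that] by (simp add: powr_of_real)
  have mem: "complex_of_real (l powr \<alpha>) \<in> resolvent_set D A" if "L < l" for l
  proof -
    have "complex_of_real l powr complex_of_real \<alpha> \<in> resolvent_set D A"
      using pos[OF that] by (intro subsetD[OF res] CollectI exI[of _ "complex_of_real l"]) simp
    then show ?thesis by (simp only: powr[OF that])
  qed
  have Q_lin: "bounded_linear (Q l)" if "L < l" for l
    using mem[OF that] by (simp add: Q_def resolvent_set_def)
  have "resolvent_transform S Q \<alpha> M w' L"
  proof (rule resolvent_transform.intro)
    show "norm (S t) \<le> M * exp (w' * t)" if "t > 0" for t
      using that M by (intro order_trans[OF bound] mult_left_mono) (auto simp: w'_def)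
    \<comment> \<open>For real \<open>l\<close> and \<open>m\<close> the scalar in
      \<open>resolvent_identity\<close> is real and leaves \<open>Q l\<close> by real
      linearity.\<close>
    show "Q l x - Q m x = (m powr \<alpha> - l powr \<alpha>) *\<^sub>R Q l (Q m x)" if "L < l" "L < m" for l m x
      using resolvent_identity[OF mem[OF that(1)] mem[OF that(2)], of x]
        linear_cmul[OF bounded_linear.linear[OF Q_lin[OF that(1)]]]
      by (simp add: Q_def scaleC_of_real flip: of_real_diff)
    show "((\<lambda>t. exp (- (l * t)) *\<^sub>R S t x) has_integral l powr (\<alpha> - 1) *\<^sub>R Q l x) {0<..}"
      if "L < l" for l x
    proof -
      have "exp (- complex_of_real l * complex_of_real t) = complex_of_real (exp (- (l * t)))" for t
        by (simp flip: exp_of_real)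
      then show ?thesis
        using lap[of "complex_of_real l" x] pos[OF that]
        by (simp only: powr[OF that] scaleC_of_real Q_def Re_complex_of_real)
    qed
  qed (auto intro: Q_lin cont simp: w'_def L_def)
  then show ?thesis by (rule resolvent_transform.solution_identity[OF _ assms(5)])
qed

end
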